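(* If $a$ is a non-negative integer, then $$\mathcal{U}_a^{\star}(q)=\sum_{t=0}^a w_t^{\star}(a) \cdot \mathbb{E}_{2t}^{\star}(q).$$
   Context: For a positive integer $a$, $$\mathcal{U}_a^{\star}(q):=\sum_{1\leq k_1\leq k_2\leq\cdots\leq k_a} \frac{q^{k_1+k_2+\cdots+k_a}}{(1-q^{k_1})^2(1-q^{k_2})^2\cdots(1-q^{k_a})^2}$$ as a formal power series in $q$, and $\mathcal{U}_0^{\star}(q)=1$. For $k\geq1$, with $B_{k}$ the $k$th Bernoulli number and $\sigma_\nu(n):=\sum_{d\mid n}d^\nu$, $$E_{2k}(q):=1-\frac{4k}{B_{2k}}\sum_{n\geq1}\sigma_{2k-1}(n)q^n.$$ Define $\mathbb{E}_0^{\star}(q):=1$ and, for $t\geq1$, $$\mathbb{E}_{2t}^{\star}(q):=\sum_{(1^{m_1},\dots,t^{m_t})\vdash t}\ \prod_{j=1}^t\frac1{m_j!}\left(-\frac{B_{2j}\,E_{2j}(q)}{(2j)\cdot (2j)!}\right)^{m_j},$$ where the sum is over all partitions of $t$, $m_j\ge 0$ being the multiplicity of the part $j$ (so $\sum_j j m_j=t$). For $0\leq t\leq a$, $$w_t(a):=\frac{\binom{2a}{a}}{16^a(2a+1)} \sum_{0\leq \ell_1<\cdots<\ell_t<a}\ \prod_{j=1}^t\frac1{(2\ell_j+1)^2},$$ where for $t=0$ the sum is $1$. The constants $w_t^{\star}(a)$ are defined by $w_0^{\star}(0):=1$; for $a>0$, $$w_0^{\star}(a):=\sum_{i=1}^a\frac{(-1)^{i-1}\binom{2i}{i}}{16^i(2i+1)}\,w_0^{\star}(a-i);$$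 and for $1\leq t\leq a$, $$w_t^{\star}(a):=(-1)^{a+t}\,4^{t-1}\,(2t-1)!\,w_{t-1}(a-1).$$ *)

theory Defs
  imports
    "HOL-Analysis.Infinite_Sum"
    "HOL-Library.FuncSet"
    "HOL-Computational_Algebra.Formal_Power_Series"
begin

text \<open>
  The variable \<open>q\<close> is \<^const>\<open>fps_X\<close>. A weakly increasing tuple of positive integers is a sorted list
  of length \<open>a\<close>. The sum over all these tuples is taken in the metric topology of \<^typ>\<open>real fps\<close>,
  which is the \<open>q\<close>-adic one: the coefficients carry the discrete topology. For \<open>a = 0\<close> the only
  tuple is the empty list, so the value is 1.
\<close>

definition U_star :: "nat \<Rightarrow> real fps" where
  "U_star a =
    (\<Sum>\<^sub>\<infinity>ks \<in> {ks :: nat list. length ks = a \<and> sorted ks \<and> (\<forall>k\<in>set ks. 1 \<le> k)}.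
      fps_X ^ sum_list ks / (\<Prod>k\<leftarrow>ks. (1 - fps_X ^ k)\<^sup>2))"

text \<open>Bernoulli numbers by their generating function \<open>z / (exp z - 1)\<close>, so \<open>B\<^sub>1 = -1/2\<close>.\<close>

definition bernoulli :: "nat \<Rightarrow> real" where
  "bernoulli n = fact n * fps_nth (fps_X / (fps_exp 1 - 1)) n"

definition divisor_sigma :: "nat \<Rightarrow> nat \<Rightarrow> nat" where
  "divisor_sigma v n = (\<Sum>d | d dvd n. d ^ v)"

text \<open>The argument is the weight \<open>2 * k\<close> halved: \<open>eisenstein k\<close> is \<open>E\<^bsub>2k\<^esub>\<close>, meant for \<open>k \<ge> 1\<close>.\<close>

definition eisenstein :: "nat \<Rightarrow> real fps" where
  "eisenstein k =
    1 - fps_const (4 * real k / bernoulli (2 * k)) *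
      Abs_fps (\<lambda>n. if n = 0 then 0 else real (divisor_sigma (2 * k - 1) n))"

text \<open>
  A partition of \<open>t\<close> is given by the multiplicities \<open>m j\<close> of its parts \<open>j = 1, \<dots>, t\<close>.
\<close>

definition partition_mults :: "nat \<Rightarrow> (nat \<Rightarrow> nat) set" where
  "partition_mults t = {m \<in> {1..t} \<rightarrow>\<^sub>E UNIV. (\<Sum>j=1..t. j * m j) = t}"

text \<open>
  \<open>E_star t\<close> has weight \<open>2 * t\<close>. For \<open>t = 0\<close> there is one (empty) partition, so the value is 1.
\<close>

definition E_star :: "nat \<Rightarrow> real fps" where
  "E_star t =
    (\<Sum>m \<in> partition_mults t. \<Prod>j=1..t.
      fps_const (1 / fact (m j)) *
      (- (fps_const (bernoulli (2 * j) / (real (2 * j) * fact (2 * j))) * eisenstein j)) ^ m j)"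

text \<open>
  The indices \<open>\<ell>\<^sub>1 < \<dots> < \<ell>\<^sub>t\<close> are the elements of a \<open>t\<close>-element subset of \<open>{0, \<dots>, a - 1}\<close>.
\<close>

definition w_const :: "nat \<Rightarrow> nat \<Rightarrow> real" where
  "w_const t a = real ((2 * a) choose a) / (16 ^ a * real (2 * a + 1)) *
    (\<Sum>L | L \<subseteq> {..<a} \<and> card L = t. \<Prod>l\<in>L. 1 / (real (2 * l + 1))\<^sup>2)"

fun w_star0 :: "nat \<Rightarrow> real" where
  "w_star0 a = (if a = 0 then 1 else
    (\<Sum>i=1..a. (-1) ^ (i - 1) * real ((2 * i) choose i) / (16 ^ i * real (2 * i + 1)) *
      w_star0 (a - i)))"

declare w_star0.simps [simp del]

definition w_star :: "nat \<Rightarrow> nat \<Rightarrow> real" where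
  "w_star t a = (if t = 0 then w_star0 a
    else (-1) ^ (a + t) * 4 ^ (t - 1) * fact (2 * t - 1) * w_const (t - 1) (a - 1))"

text \<open>The infinite sum converges and the sum over partitions is finite, so neither takes a junk value.\<close>

lemma finite_partition_mults: "finite (partition_mults t)"
proof (rule finite_subset)
  show "partition_mults t \<subseteq> {1..t} \<rightarrow>\<^sub>E {..t}"
  proof
    fix m assume m: "m \<in> partition_mults t"
    have "m j \<le> t" if "j \<in> {1..t}" for j
    proof -
      have "m j \<le> j * m j" using that by auto
      also have "\<dots> \<le> (\<Sum>j=1..t. j * m j)"
        by (rule member_le_sum) (use that in auto)
      also have "\<dots> = t" using m by (auto simp: partition_mults_def)
      finally show ?thesis .
    qed
    then show "m \<in> {1..t} \<rightarrow>\<^sub>E {..t}"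
      using m by (auto simp: partition_mults_def PiE_iff)
  qed
qed (auto intro: finite_PiE)

lemma U_star_summable:
  "(\<lambda>ks. fps_X ^ sum_list ks / (\<Prod>k\<leftarrow>ks. (1 - fps_X ^ k)\<^sup>2) :: real fps)
     summable_on {ks :: nat list. length ks = a \<and> sorted ks \<and> (\<forall>k\<in>set ks. 1 \<le> k)}"
  (is "?f summable_on ?A")
proof -
  define S where "S = Abs_fps (\<lambda>n. \<Sum>ks | ks \<in> ?A \<and> sum_list ks \<le> n. fps_nth (?f ks) n)"
  have fin: "finite {ks \<in> ?A. sum_list ks \<le> n}" for n
    by (rule finite_subset[OF _ finite_lists_length_eq[of "{..n}" a]])
      (auto dest: member_le_sum_list)
  have zero: "fps_nth (?f ks) n = 0" if "ks \<in> ?A" "n < sum_list ks" for ks n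
  proof -
    have "fps_nth (\<Prod>k\<leftarrow>xs. (1 - fps_X ^ k)\<^sup>2 :: real fps) 0 = 1"
      if "\<forall>k\<in>set xs. 1 \<le> k" for xs :: "nat list"
      using that by (induction xs) (auto simp: power2_eq_square fps_X_power_iff)
    then have "?f ks = fps_X ^ sum_list ks * inverse (\<Prod>k\<leftarrow>ks. (1 - fps_X ^ k)\<^sup>2)"
      using that by (subst fps_divide_unit) auto
    then show ?thesis using that by (simp add: fps_X_power_mult_nth)
  qed
  have "(sum ?f \<longlongrightarrow> S) (finite_subsets_at_top ?A)"
  proof (rule tendsto_fpsI)
    fix n
    show "\<forall>\<^sub>F F in finite_subsets_at_top ?A. fps_nth (sum ?f F) n = fps_nth S n"
      unfolding eventually_finite_subsets_at_top
    proof (intro exI conjI allI impI)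
      show "finite {ks \<in> ?A. sum_list ks \<le> n}" by (rule fin)
      show "{ks \<in> ?A. sum_list ks \<le> n} \<subseteq> ?A" by auto
      fix F assume F: "finite F \<and> {ks \<in> ?A. sum_list ks \<le> n} \<subseteq> F \<and> F \<subseteq> ?A"
      have "(\<Sum>ks\<in>F. fps_nth (?f ks) n) = (\<Sum>ks | ks \<in> ?A \<and> sum_list ks \<le> n. fps_nth (?f ks) n)"
      proof (rule sum.mono_neutral_right)
        show "\<forall>ks\<in>F - {ks. ks \<in> ?A \<and> sum_list ks \<le> n}. fps_nth (?f ks) n = 0"
        proof
          fix ks assume "ks \<in> F - {ks. ks \<in> ?A \<and> sum_list ks \<le> n}"
          then have "ks \<in> ?A" "n < sum_list ks" using F by auto
          then show "fps_nth (?f ks) n = 0" by (rule zero)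
        qed
      qed (use F in auto)
      then show "fps_nth (sum ?f F) n = fps_nth S n" by (simp add: S_def fps_sum_nth)
    qed
  qed
  then show ?thesis unfolding summable_on_def has_sum_def by blast
qed

end

theory Submission
  imports Defs
begin

text \<open>
  The generating function \<open>\<Sum>a. U\<^sup>*\<^sub>a x\<^sup>a\<close> is \<open>\<Prod>k. (1 - x q\<^sup>k / (1 - q\<^sup>k)\<^sup>2)\<^sup>-\<^sup>1\<close>. Substituting
  \<open>x = s(z) = exp z + exp (- z) - 2 = (2 sinh (z / 2))\<^sup>2\<close> turns the factors into
  \<open>(1 - q\<^sup>k exp z) (1 - q\<^sup>k exp (- z)) / (1 - q\<^sup>k)\<^sup>2\<close>, whose logarithmic \<open>z\<close>-derivatives are geometric
  series and add up to a series with divisor sums as coefficients. The recursion for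
  partition sums gives the logarithmic derivative of \<open>\<Sum>t. E\<^sup>*\<^sub>t z\<^bsup>2t\<^esup>\<close>; the constant terms of the
  Eisenstein series contribute that of \<open>z / (2 sinh (z / 2))\<close>. Hence
  \<open>\<Sum>a. U\<^sup>*\<^sub>a s(z)\<^sup>a = (2 sinh (z / 2) / z) \<Sum>t. E\<^sup>*\<^sub>t z\<^bsup>2t\<^esup>\<close>.
  Putting \<open>z = 2 arsinh (y / 2)\<close>, so that \<open>s(z) = y\<^sup>2\<close>, and comparing coefficients of \<open>y\<^bsup>2a\<^esup>\<close> leaves
  the power series coefficients of \<open>y z\<^bsup>2t-1\<^esup>\<close>, which obey a linear recurrence because
  \<open>(1 + y\<^sup>2 / 4) z'\<^sup>2 = 1\<close>.
\<close>

unbundle fps_syntax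

subsection \<open>Even Bernoulli numbers do not vanish\<close>

text \<open>This is \<open>(z / 2) coth (z / 2)\<close>; the linear term of \<open>z / (exp z - 1)\<close> is cancelled.\<close>

definition bern_fps :: "real fps" where
  "bern_fps = fps_X / (fps_exp 1 - 1) + fps_const (1/2) * fps_X"

lemma fps_exp_half_mult:
  "fps_exp (1/2) * fps_exp (1/2) = (fps_exp 1 :: real fps)"
  "fps_exp (1/2) * fps_exp (-1/2) = (1 :: real fps)"
  "fps_exp (-1/2) * fps_exp (-1/2) = (fps_exp (-1) :: real fps)"
  by (simp_all flip: fps_exp_add_mult)

text \<open>Both series have subdegree 1, so the quotient defining the Bernoulli numbers is a true
  one.\<close>

lemma fps_exp_minus_1_dvd_fps_X: "(fps_exp 1 - 1 :: real fps) dvd fps_X"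
proof -
  have "subdegree (fps_exp 1 - 1 :: real fps) = 1"
    by (intro subdegreeI) auto
  then show ?thesis by (simp add: fps_dvd_iff)
qed

lemma bern_quotient_mult: "fps_X / (fps_exp 1 - 1) * (fps_exp 1 - 1) = (fps_X :: real fps)"
  by (rule dvd_div_mult_self[OF fps_exp_minus_1_dvd_fps_X])

text \<open>With \<open>D = exp z - 1\<close> one has \<open>D' = D + 1\<close>. Differentiating
  \<open>B * D = z\<close> and cancelling \<open>D\<close> gives
  \<open>z B' + z B + B^2 - B = 0\<close>; the shift of \<open>B\<close> by \<open>z / 2\<close>
  completes the square.\<close>

lemma bern_fps_riccati:
  "bern_fps - fps_X * fps_deriv bern_fps = bern_fps\<^sup>2 - fps_const (1/4) * fps_X\<^sup>2"
proof -
  define D where "D = (fps_exp 1 - 1 :: real fps)"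
  define B where "B = fps_X / D"
  have D: "fps_deriv D = D + 1" by (simp add: D_def)
  have BD: "B * D = fps_X" using bern_quotient_mult by (simp add: B_def D_def)
  have "fps_deriv (B * D) = 1" by (simp add: BD)
  then have *: "fps_deriv B * D + B * (D + 1) = 1" by (simp add: D algebra_simps)
  have "(fps_X * fps_deriv B + fps_X * B + B * B - B) * D =
      fps_X * (fps_deriv B * D + B * (D + 1)) - fps_X + B * (B * D - fps_X) + (fps_X - B * D)"
    by (simp add: algebra_simps)
  also have "\<dots> = 0" by (simp add: * BD)
  finally have "fps_X * fps_deriv B + fps_X * B + B * B - B = 0"
    by (simp add: D_def)
  moreover have f: "bern_fps = B + fps_const (1/2) * fps_X"
    by (simp add: bern_fps_def B_def D_def)
  moreover have "(fps_const (1/2) :: real fps) + fps_const (1/2) = 1"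
    "(fps_const (1/2) :: real fps) * fps_const (1/2) = fps_const (1/4)"
    by (simp_all flip: fps_const_1_eq_1)
  ultimately show ?thesis unfolding f power2_eq_square fps_deriv_add fps_deriv_mult
    fps_deriv_fps_X fps_deriv_const by algebra
qed

lemma bern_fps_nth_0: "bern_fps $ 0 = 1"
proof -
  have "(fps_X / (fps_exp 1 - 1) * (fps_exp 1 - 1) :: real fps) $ 1 = 1"
    by (simp add: bern_quotient_mult)
  then show ?thesis by (simp add: bern_fps_def fps_mult_nth)
qed

text \<open>In the coefficient of the square, the two end terms of the convolution are
  \<open>bern_fps $ n\<close> each and move to the left.\<close>

lemma bern_fps_rec:
  assumes "n \<ge> 1"
  shows "- (1 + real n) * bern_fps $ n =
    (\<Sum>i\<in>{0<..<n}. bern_fps $ i * bern_fps $ (n - i)) - (if n = 2 then 1/4 else 0)"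
proof -
  have "(\<Sum>i=0..n. bern_fps $ i * bern_fps $ (n - i)) =
      (\<Sum>i\<in>{0<..<n}. bern_fps $ i * bern_fps $ (n - i)) + 2 * bern_fps $ n"
  proof -
    have "{0..n} = insert 0 (insert n {0<..<n})" using assms by auto
    then show ?thesis using assms by (simp add: bern_fps_nth_0)
  qed
  moreover have "(bern_fps - fps_X * fps_deriv bern_fps) $ n =
      (bern_fps\<^sup>2 - fps_const (1/4) * fps_X\<^sup>2) $ n"
    by (simp only: bern_fps_riccati)
  then have "bern_fps $ n - real n * bern_fps $ n =
      (\<Sum>i=0..n. bern_fps $ i * bern_fps $ (n - i)) - (if n = 2 then 1/4 else 0)"
    using assms by (simp add: power2_eq_square[of bern_fps] fps_mult_nth[of bern_fps]
        fps_X_power_iff)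
  ultimately show ?thesis by (simp add: algebra_simps)
qed

text \<open>For odd \<open>n\<close> every product in the recursion has a factor of smaller odd
  index, and the extra term occurs only at \<open>n = 2\<close>.\<close>

lemma bern_fps_nth_odd: "odd n \<Longrightarrow> bern_fps $ n = 0"
proof (induction n rule: less_induct)
  case (less n)
  have n: "n \<ge> 1" using less.prems by (cases n) auto
  have "bern_fps $ i * bern_fps $ (n - i) = 0" if "i \<in> {0<..<n}" for i
  proof (cases "odd i")
    case False
    then have "odd (n - i)" "n - i < n" using that less.prems by auto
    then show ?thesis using less.IH by simp
  qed (use that less.IH in auto)
  then have "- (1 + real n) * bern_fps $ n = 0"
    using less.prems by (subst bern_fps_rec[OF n]) (auto simp: sum.neutral)
  then show ?case by (simp add: add_eq_0_iff)
qed

text \<open>By induction the nonzero products in the recursion all have the sign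
  \<open>(-1) ^ j\<close>, so nothing cancels; the term \<open>1/4\<close> starts the
  induction.\<close>

lemma bern_fps_nth_even_sign: "j \<ge> 1 \<Longrightarrow> (-1) ^ (j + 1) * bern_fps $ (2 * j) > 0"
proof (induction j rule: less_induct)
  case (less j)
  define S where "S = (\<Sum>i\<in>{0<..<2*j}. bern_fps $ i * bern_fps $ (2 * j - i))"
  have rec: "- (1 + real (2*j)) * bern_fps $ (2*j) = S - (if j = 1 then 1/4 else 0)"
    unfolding S_def using bern_fps_rec[of "2*j"] less.prems by auto
  have S: "(-1) ^ j * S = (\<Sum>i\<in>{0<..<2*j}. (-1) ^ j * (bern_fps $ i * bern_fps $ (2 * j - i)))"
    by (simp add: S_def sum_distrib_left)
  have nn: "(-1) ^ j * (bern_fps $ i * bern_fps $ (2 * j - i)) \<ge> 0 \<and>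
      (even i \<longrightarrow> (-1) ^ j * (bern_fps $ i * bern_fps $ (2 * j - i)) > 0)"
    if i: "i \<in> {0<..<2*j}" for i
  proof (cases "odd i")
    case True
    then show ?thesis by (simp add: bern_fps_nth_odd)
  next
    case False
    then obtain l where l: "i = 2 * l" by auto
    then have l': "l \<ge> 1" "l < j" "j - l \<ge> 1" "j - l < j" using i by auto
    have "0 < ((-1) ^ (l + 1) * bern_fps $ (2 * l)) * ((-1) ^ (j - l + 1) * bern_fps $ (2 * (j - l)))"
      by (intro mult_pos_pos less.IH l')
    also have "\<dots> = (-1) ^ (l + 1 + (j - l + 1)) * (bern_fps $ (2 * l) * bern_fps $ (2 * (j - l)))"
      by (simp add: power_add)
    also have "l + 1 + (j - l + 1) = j + 2" using l' by simp
    also have "2 * (j - l) = 2 * j - i" using l by simp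
    finally show ?thesis using l by simp
  qed
  show ?case
  proof (cases "j = 1")
    case True
    have "{0<..<2::nat} = {1}" by auto
    then have "S = 0" using True by (simp add: S_def bern_fps_nth_odd)
    then show ?thesis using rec True by simp
  next
    case False
    then have "j \<ge> 2" using less.prems by simp
    \<comment> \<open>Index 2 is even and in range because \<open>j \<ge> 2\<close>, so one summand
      is strictly positive.\<close>
    then have "(-1) ^ j * S > 0"
      unfolding S by (intro sum_pos2[of _ 2]) (use nn in auto)
    also have "(-1) ^ j * S = (1 + real (2*j)) * ((-1) ^ (j + 1) * bern_fps $ (2 * j))"
    proof -
      have "S = - (1 + real (2*j)) * bern_fps $ (2*j)" using rec False by simp
      then show ?thesis by (simp only: power_add power_one_right) (simp add: algebra_simps)
    qed
    finally show ?thesis by (rule zero_less_mult_pos) simp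
  qed
qed

lemma bernoulli_even: "j \<ge> 1 \<Longrightarrow> bernoulli (2 * j) / fact (2 * j) = bern_fps $ (2 * j)"
  by (simp add: bernoulli_def bern_fps_def)

text \<open>\<^const>\<open>eisenstein\<close> divides by these numbers.\<close>

lemma bernoulli_even_nonzero: "j \<ge> 1 \<Longrightarrow> bernoulli (2 * j) \<noteq> 0"
  using bernoulli_even[of j] bern_fps_nth_even_sign[of j] by auto

subsection \<open>The series of \<open>2 sinh (z / 2)\<close> and its inverse\<close>

definition dsinh_fps :: "real fps" where
  "dsinh_fps = fps_exp (1/2) - fps_exp (-1/2)"

text \<open>This is \<open>2 sinh (z / 2) / z\<close>; the shift divides exactly because the
  constant term is 0.\<close>

definition dsinhc_fps :: "real fps" where
  "dsinhc_fps = fps_shift 1 dsinh_fps"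

lemma dsinh_fps_nth [simp]: "dsinh_fps $ 0 = 0" "dsinh_fps $ Suc 0 = 1"
  by (simp_all add: dsinh_fps_def)

lemma dsinh_fps_eq: "dsinh_fps = fps_X * dsinhc_fps"
  unfolding dsinhc_fps_def by (rule fps_ext) (auto simp: fps_X_mult_nth gr0_conv_Suc)

lemma dsinhc_fps_nth_0: "dsinhc_fps $ 0 = 1"
  by (simp add: dsinhc_fps_def)

lemma dsinh_fps_power2: "dsinh_fps\<^sup>2 = fps_exp 1 + fps_exp (-1) - 2"
proof -
  have "dsinh_fps\<^sup>2 = fps_exp (1/2) * fps_exp (1/2) + fps_exp (-1/2) * fps_exp (-1/2)
      - 2 * (fps_exp (1/2) * fps_exp (-1/2))"
    by (simp only: dsinh_fps_def power2_eq_square) algebra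
  then show ?thesis by (simp only: fps_exp_half_mult mult_1_right)
qed

text \<open>This is \<open>cosh^2 = 1 + sinh^2\<close> at \<open>z / 2\<close>; it yields the
  differential equation of the inverse series.\<close>

lemma deriv_dsinh_fps_power2: "(fps_deriv dsinh_fps)\<^sup>2 = 1 + fps_const (1/4) * dsinh_fps\<^sup>2"
proof -
  have 1: "fps_deriv dsinh_fps = fps_const (1/2) * (fps_exp (1/2) + fps_exp (-1/2))"
    by (simp add: dsinh_fps_def algebra_simps flip: fps_const_neg)
  have 2: "(fps_const (1/4) :: real fps) = fps_const (1/2) * fps_const (1/2)" "4 * fps_const (1/4) = (1 :: real fps)"
    by (simp_all add: numeral_fps_const)
  show ?thesis using fps_exp_half_mult(2) 2 unfolding 1 power2_eq_square unfolding dsinh_fps_def by algebra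
qed

text \<open>The logarithmic derivative of \<open>2 sinh (z / 2)\<close> is
  \<open>coth (z / 2) / 2\<close>, and dividing by \<open>z\<close> subtracts \<open>1 / z\<close>;
  multiplied by \<open>z\<close> this is \<open>bern_fps - 1\<close>.\<close>

lemma fps_X_deriv_dsinhc: "fps_X * fps_deriv dsinhc_fps = dsinhc_fps * (bern_fps - 1)"
proof -
  define e where "e = (fps_exp (1/2) :: real fps)"
  define e' where "e' = (fps_exp (-1/2) :: real fps)"
  define h where "h = (fps_const (1/2) :: real fps)"
  define B where "B = (fps_X / (fps_exp 1 - 1) :: real fps)"
  have h: "h + h = 1" by (simp add: h_def flip: fps_const_1_eq_1)
  have ee: "e * e' = 1" by (simp only: e_def e'_def fps_exp_half_mult)
  have \<kappa>: "fps_deriv dsinh_fps = h * (e + e')"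
    by (simp add: dsinh_fps_def e_def e'_def h_def algebra_simps flip: fps_const_neg)
  have B: "B * (e * e - 1) = fps_X"
    using bern_quotient_mult by (simp only: e_def B_def fps_exp_half_mult)
  have f: "bern_fps = B + h * fps_X" by (simp add: bern_fps_def h_def B_def)
  have \<sigma>: "fps_X * dsinhc_fps = e - e'" unfolding dsinh_fps_eq[symmetric] by (simp add: dsinh_fps_def e_def e'_def)
  \<comment> \<open>Multiplication by \<open>e' = exp (- z / 2)\<close> turns
    \<open>exp z - 1\<close> into \<open>2 sinh (z / 2)\<close>.\<close>
  have "B * (e - e') = e' * (B * (e * e - 1)) + B * e * (1 - e * e')" by (simp add: algebra_simps)
  then have "B * (e - e') = e' * fps_X" by (simp only: B ee) simp
  then have *: "(e - e') * bern_fps = fps_X * fps_deriv dsinh_fps"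
    using h unfolding f \<kappa> by algebra
  have "fps_deriv dsinh_fps = dsinhc_fps + fps_X * fps_deriv dsinhc_fps"
    unfolding dsinh_fps_eq by simp
  then have "fps_X * (fps_X * fps_deriv dsinhc_fps) = fps_X * (dsinhc_fps * (bern_fps - 1))"
    using * \<sigma> by algebra
  then show ?thesis by simp
qed

section \<open>The inverse series \<open>2 arsinh (y / 2)\<close> and its differential
  equations\<close>

definition darsinh_fps :: "real fps" where
  "darsinh_fps = fps_inv dsinh_fps"

lemma darsinh_fps_nth [simp]: "darsinh_fps $ 0 = 0" "darsinh_fps $ Suc 0 = 1"
  by (simp_all add: darsinh_fps_def fps_inv_def)

lemma dsinh_darsinh: "dsinh_fps oo darsinh_fps = fps_X"
  unfolding darsinh_fps_def by (rule fps_inv_right) simp_all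

text \<open>The chain rule makes \<open>darsinh'\<close> the reciprocal of
  \<open>dsinh' o darsinh\<close>, whose square is \<open>1 + y^2 / 4\<close> by the hyperbolic
  identity.\<close>

lemma deriv_darsinh_power2: "(fps_deriv darsinh_fps)\<^sup>2 * (1 + fps_const (1/4) * fps_X\<^sup>2) = 1"
proof -
  define u where "u = fps_deriv dsinh_fps oo darsinh_fps"
  have u: "u * fps_deriv darsinh_fps = 1"
    using arg_cong[OF dsinh_darsinh, of fps_deriv] by (simp add: fps_compose_deriv u_def)
  have "u\<^sup>2 = (fps_deriv dsinh_fps)\<^sup>2 oo darsinh_fps"
    by (simp add: u_def fps_compose_power)
  also have "\<dots> = 1 + fps_const (1/4) * fps_X\<^sup>2"
    unfolding deriv_dsinh_fps_power2
    by (simp add: fps_compose_add_distrib fps_compose_mult_distrib dsinh_darsinh flip: fps_compose_power)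
  finally show ?thesis using u by algebra
qed

text \<open>Differentiating the quadratic equation and cancelling \<open>2 * darsinh'\<close> leaves
  a linear one.\<close>

lemma deriv2_darsinh:
  "fps_deriv (fps_deriv darsinh_fps) * (1 + fps_const (1/4) * fps_X\<^sup>2)
    + fps_const (1/4) * fps_X * fps_deriv darsinh_fps = 0"
proof -
  define g1 where "g1 = fps_deriv darsinh_fps"
  have g: "g1\<^sup>2 * (1 + fps_const (1/4) * fps_X\<^sup>2) = 1"
    using deriv_darsinh_power2 by (simp add: g1_def)
  then have "fps_deriv (g1\<^sup>2 * (1 + fps_const (1/4) * fps_X\<^sup>2)) = 0" by simp
  then have "2 * g1 * (fps_deriv g1 * (1 + fps_const (1/4) * fps_X\<^sup>2) + fps_const (1/4) * fps_X * g1) = 0"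
    by (simp add: power2_eq_square algebra_simps)
  moreover have "2 * g1 \<noteq> 0" using g by auto
  ultimately show ?thesis unfolding g1_def by (simp add: mult_eq_0_iff)
qed

text \<open>In terms of \<open>z = darsinh y\<close> the operator on the left is the second
  derivative in \<open>z\<close>, so it lowers the exponent by two.\<close>

lemma deriv2_darsinh_power:
  "fps_deriv (fps_deriv (darsinh_fps ^ (k + 2))) * (1 + fps_const (1/4) * fps_X\<^sup>2)
    + fps_const (1/4) * fps_X * fps_deriv (darsinh_fps ^ (k + 2))
    = of_nat ((k + 2) * (k + 1)) * darsinh_fps ^ k"
proof -
  define g where "g = darsinh_fps"
  define G where "G = g ^ k"
  have d: "fps_deriv (g ^ Suc m) = of_nat (Suc m) * fps_deriv g * g ^ m" for m
    using fps_deriv_power[of g "Suc m"] by (simp only: fps_of_nat diff_Suc_1)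
  have d1: "fps_deriv (g ^ (k + 2)) = of_nat (k + 2) * fps_deriv g * (g * G)"
    using d[of "k + 1"] by (simp add: G_def)
  have "fps_deriv (g * G) = of_nat (k + 1) * fps_deriv g * G"
    using d[of k] by (simp add: G_def)
  then have d2: "fps_deriv (fps_deriv (g ^ (k + 2))) =
      of_nat (k + 2) * (fps_deriv (fps_deriv g) * (g * G) + fps_deriv g * (of_nat (k + 1) * fps_deriv g * G))"
    unfolding d1 fps_deriv_mult by (simp add: algebra_simps)
  show ?thesis using deriv_darsinh_power2 deriv2_darsinh
    unfolding g_def[symmetric] d2 G_def[symmetric] of_nat_mult unfolding d1 by algebra
qed

section \<open>Coefficients of the odd powers of the inverse series\<close>

lemma w_const_Suc:
  "real ((2 * n + 3) * (2 * n + 2)) * w_const t (Suc n) =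
    (real (2 * n + 1))\<^sup>2 / 4 * w_const t n + (if t = 0 then 0 else w_const (t - 1) n / 4)"
proof -
  define p where "p = (\<lambda>L. \<Prod>l\<in>L. 1 / (real (2 * l + 1))\<^sup>2)"
  define c where "c = (\<lambda>n. real ((2 * n) choose n) / (16 ^ n * real (2 * n + 1)))"
  define e where "e = (\<lambda>t n. \<Sum>L | L \<subseteq> {..<n} \<and> card L = t. p L)"
  have w: "w_const t n = c n * e t n" for t n
    by (simp add: w_const_def c_def e_def p_def)
  have ch: "real (Suc n) * real ((2 * Suc n) choose Suc n) = 2 * real (2 * n + 1) * real ((2 * n) choose n)"
  proof -
    have "Suc n * ((2 * Suc n) choose Suc n) = 2 * Suc n * (Suc (2 * n) choose n)"
      using Suc_times_binomial[of n "Suc (2 * n)"] by simp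
    moreover have "Suc n * (Suc (2 * n) choose n) = Suc (2 * n) * ((2 * n) choose n)"
      using Suc_times_binomial_eq[of "2 * n" n] binomial_symmetric[of n "Suc (2 * n)"] by simp
    ultimately have "Suc n * (Suc n * ((2 * Suc n) choose Suc n)) = Suc n * (2 * (2 * n + 1) * ((2 * n) choose n))"
      by (metis (no_types, lifting) Suc_eq_plus1 mult.assoc mult.left_commute)
    then have "Suc n * ((2 * Suc n) choose Suc n) = 2 * (2 * n + 1) * ((2 * n) choose n)"
      by (rule Suc_mult_cancel1[THEN iffD1])
    then show ?thesis by (metis of_nat_mult of_nat_numeral)
  qed
  have c: "real ((2 * n + 3) * (2 * n + 2)) * c (Suc n) = (real (2 * n + 1))\<^sup>2 / 4 * c n"
  proof -
    define b where "b = real ((2 * Suc n) choose Suc n)"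
    have "c (Suc n) = b / (16 * 16 ^ n * real (2 * n + 3))"
      by (simp add: c_def b_def numeral_3_eq_3)
    moreover have "real ((2 * n + 3) * (2 * n + 2)) = real (2 * n + 3) * (2 * real (Suc n))"
      by (simp add: algebra_simps)
    ultimately have "real ((2 * n + 3) * (2 * n + 2)) * c (Suc n) = 2 * (real (Suc n) * b) / (16 * 16 ^ n)"
      by (simp del: of_nat_add of_nat_Suc)
    also have "\<dots> = real (2 * n + 1) * real ((2 * n) choose n) / (4 * 16 ^ n)"
      unfolding b_def ch by (simp add: field_simps)
    also have "\<dots> = (real (2 * n + 1))\<^sup>2 / 4 * c n"
      unfolding c_def power2_eq_square by (simp del: of_nat_add of_nat_mult)
    finally show ?thesis .
  qed
  \<comment> \<open>\<open>e t n\<close> is the elementary symmetric polynomial in the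
    \<open>1 / (2 l + 1)^2\<close>; subsets are split by whether they contain
    \<open>n\<close>.\<close>
  have e: "e t (Suc n) = e t n + (if t = 0 then 0 else e (t - 1) n / (real (2 * n + 1))\<^sup>2)"
  proof (cases t)
    case 0
    have "{L. L \<subseteq> {..<m} \<and> card L = 0} = {{}}" for m :: nat
      by (auto dest: finite_subset)
    then show ?thesis using 0 by (simp add: e_def)
  next
    case (Suc s)
    let ?A = "{L. L \<subseteq> {..<n} \<and> card L = t}" and ?B = "{L. L \<subseteq> {..<n} \<and> card L = s}"
    have "{L. L \<subseteq> {..<Suc n} \<and> card L = t} = ?A \<union> insert n ` ?B" (is "?C = _")
    proof (intro equalityI subsetI)
      fix L assume L: "L \<in> ?C"
      then have fin: "finite L" by (auto dest: finite_subset)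
      show "L \<in> ?A \<union> insert n ` ?B"
      proof (cases "n \<in> L")
        case True
        then have "L = insert n (L - {n})" "L - {n} \<in> ?B"
          using L Suc fin by (auto simp: card_Diff_singleton less_Suc_eq)
        then show ?thesis by blast
      qed (use L in \<open>auto simp: lessThan_Suc\<close>)
    next
      fix L assume "L \<in> ?A \<union> insert n ` ?B"
      then show "L \<in> ?C"
      proof
        assume "L \<in> insert n ` ?B"
        then obtain M where M: "L = insert n M" "M \<subseteq> {..<n}" "card M = s" by auto
        then have "finite M" "n \<notin> M" by (auto dest: finite_subset)
        then show ?thesis using M Suc by (auto simp: lessThan_Suc)
      qed auto
    qed
    then have "e t (Suc n) = e t n + (\<Sum>L\<in>insert n ` ?B. p L)"
      unfolding e_def by (subst sum.union_disjoint[symmetric]) auto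
    also have "(\<Sum>L\<in>insert n ` ?B. p L) = (\<Sum>L\<in>?B. p (insert n L))"
    proof (rule sum.reindex[unfolded comp_def])
      have nin: "n \<notin> L" if "L \<in> ?B" for L using that by auto
      show "inj_on (insert n) ?B"
        by (rule inj_onI) (metis nin insert_ident)
    qed
    also have "\<dots> = (\<Sum>L\<in>?B. p L / (real (2 * n + 1))\<^sup>2)"
    proof (rule sum.cong)
      fix L assume L: "L \<in> ?B"
      then have "finite L" "n \<notin> L" by (auto dest: finite_subset)
      then show "p (insert n L) = p L / (real (2 * n + 1))\<^sup>2" by (simp add: p_def)
    qed simp
    finally show ?thesis using Suc by (simp add: e_def sum_divide_distrib)
  qed
  have "real ((2 * n + 3) * (2 * n + 2)) * w_const t (Suc n) =
      (real (2 * n + 1))\<^sup>2 / 4 * c n * (e t n + (if t = 0 then 0 else e (t - 1) n / (real (2 * n + 1))\<^sup>2))"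
    unfolding w e c[symmetric] by simp
  \<comment> \<open>The square cancels the denominator of the new factor, which leaves
    \<open>w_const (t - 1) n / 4\<close>.\<close>
  moreover have "(real (2 * n + 1))\<^sup>2 \<noteq> 0" by simp
  ultimately show ?thesis unfolding w by (simp add: distrib_left del: of_nat_add of_nat_mult)
qed

lemma w_const_0_right: "w_const t 0 = (if t = 0 then 1 else 0)"
proof -
  have "{L :: nat set. L \<subseteq> {..<0} \<and> card L = t} = (if t = 0 then {{}} else {})"
    by auto
  then show ?thesis by (simp add: w_const_def)
qed

lemma w_const_0_left: "w_const 0 n = real ((2 * n) choose n) / (16 ^ n * real (2 * n + 1))"
proof -
  have "{L. L \<subseteq> {..<n} \<and> card L = 0} = {{}}" by (auto dest: finite_subset)
  then show ?thesis by (simp add: w_const_def)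
qed

text \<open>The contributions \<open>m (m - 1) / 4\<close> and \<open>m / 4\<close> to the
  coefficient of \<open>F $ m\<close> add up to \<open>m^2 / 4\<close>.\<close>

lemma darsinh_operator_nth:
  fixes F :: "real fps"
  shows "(fps_deriv (fps_deriv F) * (1 + fps_const (1/4) * fps_X\<^sup>2)
      + fps_const (1/4) * fps_X * fps_deriv F) $ m =
    real ((m + 2) * (m + 1)) * F $ (m + 2) + (real m)\<^sup>2 / 4 * F $ m"
proof -
  have "fps_deriv (fps_deriv F) * (1 + fps_const (1/4) * fps_X\<^sup>2)
      + fps_const (1/4) * fps_X * fps_deriv F =
    fps_deriv (fps_deriv F) + fps_const (1/4) * (fps_X * (fps_X * fps_deriv (fps_deriv F)) + fps_X * fps_deriv F)"
    by (simp add: power2_eq_square algebra_simps)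
  then show ?thesis
    by (cases m; cases "m - 1") (auto simp: fps_X_mult_nth power2_eq_square algebra_simps)
qed

lemma darsinh_nth_rec:
  "real ((m + 2) * (m + 1)) * darsinh_fps $ (m + 2) = - (real m)\<^sup>2 / 4 * darsinh_fps $ m"
  using darsinh_operator_nth[of darsinh_fps m] unfolding deriv2_darsinh by simp

lemma darsinh_nth_even: "darsinh_fps $ (2 * n) = 0"
proof (induction n)
  case (Suc n)
  have "real ((2 * n + 2) * (2 * n + 1)) * darsinh_fps $ (2 * n + 2) = 0"
    unfolding darsinh_nth_rec using Suc by simp
  then show ?case by (simp del: of_nat_mult of_nat_add)
qed simp

text \<open>Both sides obey the same recurrence in \<open>n\<close>: the left through the operator,
  the right by \<open>w_const_Suc\<close>. It couples \<open>t\<close> with \<open>t - 1\<close>, so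
  \<open>t\<close> stays arbitrary in the induction.\<close>

lemma darsinh_power_nth:
  "(darsinh_fps ^ (2 * t + 1)) $ (2 * n + 1) = (-1) ^ (n + t) * 4 ^ t * fact (2 * t + 1) * w_const t n"
proof (induction n arbitrary: t)
  case 0
  show ?case
    by (cases t) (simp_all add: w_const_0_right startsby_zero_power_prefix)
next
  case (Suc n)
  define K where "K = real ((2 * n + 3) * (2 * n + 2))"
  have K: "K \<noteq> 0" by (simp add: K_def del: of_nat_mult)
  have K': "K = real ((2 * n + 1 + 2) * (2 * n + 1 + 1))" by (simp add: K_def algebra_simps)
  show ?case
  proof (cases t)
    case 0
    \<comment> \<open>For \<open>t = 0\<close> the operator annihilates the series, so no lower
      power enters.\<close>
    have "K * darsinh_fps $ (2 * n + 1 + 2) = - (real (2 * n + 1))\<^sup>2 / 4 * darsinh_fps $ (2 * n + 1)"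
      unfolding K' by (rule darsinh_nth_rec)
    also have "darsinh_fps $ (2 * n + 1) = (-1) ^ n * w_const 0 n" using Suc[of 0] by simp
    also have "- (real (2 * n + 1))\<^sup>2 / 4 * ((-1) ^ n * w_const 0 n) =
        (-1) ^ Suc n * ((real (2 * n + 1))\<^sup>2 / 4 * w_const 0 n)" by simp
    also have "\<dots> = K * ((-1) ^ Suc n * w_const 0 (Suc n))"
      using w_const_Suc[of n 0] by (simp add: K_def del: of_nat_mult of_nat_add)
    finally have "darsinh_fps $ (2 * n + 1 + 2) = (-1) ^ Suc n * w_const 0 (Suc n)"
      by (rule mult_left_cancel[OF K, THEN iffD1])
    then show ?thesis using 0 by simp
  next
    case (Suc s)
    define G where "G = darsinh_fps ^ (2 * t + 1)"
    have "(2 * s + 1) + 2 = 2 * t + 1" using Suc by simp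
    then have "K * G $ (2 * n + 1 + 2) + (real (2 * n + 1))\<^sup>2 / 4 * G $ (2 * n + 1) =
        (of_nat ((2 * s + 3) * (2 * s + 2)) * darsinh_fps ^ (2 * s + 1)) $ (2 * n + 1)"
      using deriv2_darsinh_power[of "2 * s + 1"] darsinh_operator_nth[of G "2 * n + 1"]
      unfolding K' by (simp add: G_def eval_nat_numeral)
    also have "\<dots> = real ((2 * s + 3) * (2 * s + 2)) * (darsinh_fps ^ (2 * s + 1)) $ (2 * n + 1)"
      by (simp only: fps_of_nat[symmetric] fps_mult_left_const_nth)
    finally have *: "K * G $ (2 * n + 1 + 2) = real ((2 * s + 3) * (2 * s + 2)) *
        ((-1) ^ (n + s) * 4 ^ s * fact (2 * s + 1) * w_const s n) -
        (real (2 * n + 1))\<^sup>2 / 4 * ((-1) ^ (n + t) * 4 ^ t * fact (2 * t + 1) * w_const t n)"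
      unfolding Suc.IH G_def by simp
    have f: "(fact (2 * t + 1) :: real) = real ((2 * s + 3) * (2 * s + 2)) * fact (2 * s + 1)"
      using Suc by (simp add: algebra_simps)
    have w: "K * w_const t (Suc n) - (real (2 * n + 1))\<^sup>2 / 4 * w_const t n = w_const s n / 4"
      using w_const_Suc[of n t] Suc by (simp add: K_def)
    \<comment> \<open>As \<open>t = s + 1\<close>, the minus sign is absorbed into
      \<open>(-1) ^ (n + s)\<close> and \<open>4 ^ s = 4 ^ t / 4\<close>, so a common factor comes
      out.\<close>
    have "K * G $ (2 * n + 1 + 2) = (-1) ^ (n + s) * 4 ^ t * fact (2 * t + 1) *
        (w_const s n / 4 + (real (2 * n + 1))\<^sup>2 / 4 * w_const t n)"
      unfolding * f using Suc by (simp add: algebra_simps)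
    also have "\<dots> = K * ((-1) ^ (Suc n + t) * 4 ^ t * fact (2 * t + 1) * w_const t (Suc n))"
      unfolding w[symmetric] using Suc by simp
    finally have "G $ (2 * n + 1 + 2) = (-1) ^ (Suc n + t) * 4 ^ t * fact (2 * t + 1) * w_const t (Suc n)"
      by (rule mult_left_cancel[OF K, THEN iffD1])
    then show ?thesis by (simp add: G_def)
  qed
qed

text \<open>Since \<open>2 sinh (z / 2) = y\<close>, the series \<open>dsinhc_fps\<close> becomes
  \<open>y / z\<close>.\<close>

lemma dsinhc_darsinh_mult: "(dsinhc_fps oo darsinh_fps) * darsinh_fps = fps_X"
proof -
  have "(fps_X * dsinhc_fps) oo darsinh_fps = fps_X"
    by (simp only: dsinh_darsinh flip: dsinh_fps_eq)
  then show ?thesis by (simp add: fps_compose_mult_distrib mult.commute)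
qed

text \<open>The product of this series with the odd series \<open>darsinh_fps\<close> is
  \<open>y\<close>. Solving the coefficient of \<open>y^(2a+1)\<close> for the term of highest index
  gives the recursion defining \<open>w_star0\<close>.\<close>

lemma dsinhc_darsinh_nth: "(dsinhc_fps oo darsinh_fps) $ (2 * a) = w_star0 a"
proof (induction a rule: less_induct)
  case (less a)
  define V where "V = dsinhc_fps oo darsinh_fps"
  have inj: "inj_on (\<lambda>i. 2 * i + 1) {0..a}" by (auto intro: inj_onI)
  have "(darsinh_fps * V) $ (2 * a + 1) = (\<Sum>j=0..2*a+1. darsinh_fps $ j * V $ (2 * a + 1 - j))"
    by (simp add: fps_mult_nth)
  also have "\<dots> = (\<Sum>j\<in>(\<lambda>i. 2 * i + 1) ` {0..a}. darsinh_fps $ j * V $ (2 * a + 1 - j))"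
  proof (rule sum.mono_neutral_right)
    show "\<forall>j\<in>{0..2*a+1} - (\<lambda>i. 2 * i + 1) ` {0..a}. darsinh_fps $ j * V $ (2 * a + 1 - j) = 0"
    proof
      fix j assume j: "j \<in> {0..2*a+1} - (\<lambda>i. 2 * i + 1) ` {0..a}"
      have "even j"
      proof (rule ccontr)
        assume "odd j"
        then obtain i where "j = 2 * i + 1" by (elim oddE)
        then show False using j by auto
      qed
      then show "darsinh_fps $ j * V $ (2 * a + 1 - j) = 0"
        by (auto simp: darsinh_nth_even elim!: evenE)
    qed
  qed auto
  also have "\<dots> = (\<Sum>i=0..a. darsinh_fps $ (2 * i + 1) * V $ (2 * (a - i)))"
    by (subst sum.reindex[OF inj]) (simp add: diff_mult_distrib2)
  also have "\<dots> = (\<Sum>i=0..a. (-1) ^ i * w_const 0 i * V $ (2 * (a - i)))"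
    using darsinh_power_nth[of 0] by simp
  also have "\<dots> = V $ (2 * a) + (\<Sum>i=1..a. (-1) ^ i * w_const 0 i * V $ (2 * (a - i)))"
    by (simp add: sum.atLeast_Suc_atMost w_const_0_right)
  also have "(\<Sum>i=1..a. (-1) ^ i * w_const 0 i * V $ (2 * (a - i))) =
      - (\<Sum>i=1..a. (-1) ^ (i - 1) * w_const 0 i * w_star0 (a - i))"
    unfolding sum_negf[symmetric]
  proof (rule sum.cong)
    fix i assume i: "i \<in> {1..a}"
    then have "(-1 :: real) ^ i = - ((-1) ^ (i - 1))" by (cases i) auto
    moreover have "V $ (2 * (a - i)) = w_star0 (a - i)"
      unfolding V_def using i by (intro less.IH) auto
    ultimately show "(-1) ^ i * w_const 0 i * V $ (2 * (a - i)) =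
        - ((-1) ^ (i - 1) * w_const 0 i * w_star0 (a - i))" by simp
  qed simp
  finally have "V $ (2 * a) = (if a = 0 then 1 else 0) +
      (\<Sum>i=1..a. (-1) ^ (i - 1) * w_const 0 i * w_star0 (a - i))"
    using dsinhc_darsinh_mult by (simp add: V_def mult.commute)
  also have "\<dots> = w_star0 a"
    by (subst w_star0.simps) (simp add: w_const_0_left)
  finally show ?case by (simp add: V_def)
qed

text \<open>For \<open>t \<ge> 1\<close> one factor \<open>z\<close> cancels and leaves
  \<open>y z^(2t-1)\<close>, which explains the shifts to \<open>t - 1\<close> and
  \<open>a - 1\<close> in \<open>w_star\<close>. For \<open>t > a\<close> the series starts in too
  high a degree.\<close>

lemma dsinhc_darsinh_power_nth:
  "((dsinhc_fps oo darsinh_fps) * darsinh_fps ^ (2 * t)) $ (2 * a) = (if t \<le> a then w_star t a else 0)"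
proof (cases t)
  case 0
  then show ?thesis by (simp add: dsinhc_darsinh_nth w_star_def)
next
  case (Suc s)
  have "(dsinhc_fps oo darsinh_fps) * darsinh_fps ^ (2 * t) =
      ((dsinhc_fps oo darsinh_fps) * darsinh_fps) * darsinh_fps ^ (2 * s + 1)"
    using Suc by (simp add: mult.assoc)
  then have *: "(dsinhc_fps oo darsinh_fps) * darsinh_fps ^ (2 * t) = fps_X * darsinh_fps ^ (2 * s + 1)"
    unfolding dsinhc_darsinh_mult .
  show ?thesis
  proof (cases "t \<le> a")
    case True
    then obtain b where b: "a = Suc b" "s \<le> b" using Suc by (cases a) auto
    have "(fps_X * darsinh_fps ^ (2 * s + 1)) $ (2 * a) = (darsinh_fps ^ (2 * s + 1)) $ (2 * b + 1)"
      using b by (simp add: fps_X_mult_nth del: power_Suc)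
    then show ?thesis
      unfolding * darsinh_power_nth using b Suc by (simp add: w_star_def)
  next
    case False
    then have "(darsinh_fps ^ (2 * s + 1)) $ (2 * a - 1) = 0"
      using Suc by (intro startsby_zero_power_prefix[rule_format]) auto
    then show ?thesis unfolding * using False by (simp add: fps_X_mult_nth)
  qed
qed

subsection \<open>Sums over partitions\<close>

text \<open>Parts larger than \<open>t\<close> must have multiplicity 0. This puts partitions of
  different numbers over one common range of part sizes, as the recursion below requires.\<close>

lemma sum_partition_mults_extend:
  fixes \<psi> :: "nat \<Rightarrow> nat \<Rightarrow> 'a :: comm_semiring_1"
  assumes \<psi>0: "\<And>j. \<psi> j 0 = 1" and "t \<le> T"
  shows "(\<Sum>m | m \<in> {1..T} \<rightarrow>\<^sub>E UNIV \<and> (\<Sum>j=1..T. j * m j) = t. \<Prod>j=1..T. \<psi> j (m j)) =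
    (\<Sum>m\<in>partition_mults t. \<Prod>j=1..t. \<psi> j (m j))"
proof -
  let ?Q = "{m \<in> {1..T} \<rightarrow>\<^sub>E UNIV. (\<Sum>j=1..T. j * m j) = t}"
  \<comment> \<open>New part sizes get multiplicity 0; outside \<open>{1..T}\<close> the value stays
    \<open>undefined\<close>, as extensional functions demand.\<close>
  define ext where "ext = (\<lambda>(m :: nat \<Rightarrow> nat) j. if j \<in> {1..t} then m j else if j \<in> {1..T} then 0 else undefined)"
  have zero: "m j = 0" if m: "m \<in> ?Q" and j: "j \<in> {1..T} - {1..t}" for m j
  proof (rule ccontr)
    assume "m j \<noteq> 0"
    have "j * m j \<le> (\<Sum>j=1..T. j * m j)" by (rule member_le_sum) (use j in auto)
    also have "\<dots> = t" using m by simp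
    finally show False using j \<open>m j \<noteq> 0\<close> by (cases "m j") auto
  qed
  have sub: "{1..t} \<subseteq> {1..T}" using assms by auto
  have sum_restrict: "(\<Sum>j=1..t. j * m j) = (\<Sum>j=1..T. j * m j)" if "m \<in> ?Q" for m
    by (rule sum.mono_neutral_left) (use sub zero[OF that] in simp_all)
  have prod_restrict: "(\<Prod>j=1..t. \<psi> j (m j)) = (\<Prod>j=1..T. \<psi> j (m j))" if "m \<in> ?Q" for m
    by (rule prod.mono_neutral_left) (use sub zero[OF that] \<psi>0 in simp_all)
  have ext_Q: "ext m \<in> ?Q" if m: "m \<in> partition_mults t" for m
  proof -
    have "(\<Sum>j=1..T. j * ext m j) = (\<Sum>j=1..t. j * ext m j)"
      by (rule sum.mono_neutral_right) (use sub in \<open>auto simp: ext_def\<close>)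
    also have "\<dots> = (\<Sum>j=1..t. j * m j)" by (rule sum.cong) (auto simp: ext_def)
    finally show ?thesis using m sub by (auto simp: partition_mults_def ext_def PiE_def extensional_def)
  qed
  show ?thesis
  proof (rule sum.reindex_bij_witness[where i = ext and j = "\<lambda>m. restrict m {1..t}"])
    fix m assume m: "m \<in> ?Q"
    show "ext (restrict m {1..t}) = m"
    proof
      fix j show "ext (restrict m {1..t}) j = m j"
        using zero[OF m, of j] m by (auto simp: ext_def PiE_def extensional_def)
    qed
    show "restrict m {1..t} \<in> partition_mults t"
      using m sum_restrict[OF m] by (auto simp: partition_mults_def)
    show "(\<Prod>j=1..t. \<psi> j (restrict m {1..t} j)) = (\<Prod>j=1..T. \<psi> j (m j))"
      unfolding prod_restrict[OF m, symmetric] by (rule prod.cong) auto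
  next
    fix m assume m: "m \<in> partition_mults t"
    show "restrict (ext m) {1..t} = m"
      using m by (auto simp: partition_mults_def ext_def PiE_def extensional_def fun_eq_iff)
    show "ext m \<in> ?Q" by (rule ext_Q[OF m])
  qed
qed

text \<open>This is the logarithmic derivative of the product of the exponential series
  \<open>\<Sum>n. \<psi> j n * x ^ (j * n)\<close>, read off coefficientwise.\<close>

lemma sum_partition_mults_rec:
  fixes \<psi> :: "nat \<Rightarrow> nat \<Rightarrow> 'a :: comm_semiring_1" and e :: "nat \<Rightarrow> 'a"
  assumes \<psi>0: "\<And>j. \<psi> j 0 = 1" and \<psi>_Suc: "\<And>j n. of_nat (Suc n) * \<psi> j (Suc n) = e j * \<psi> j n"
  shows "of_nat t * (\<Sum>m\<in>partition_mults t. \<Prod>j=1..t. \<psi> j (m j)) =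
    (\<Sum>i=1..t. of_nat i * e i * (\<Sum>m\<in>partition_mults (t - i). \<Prod>j=1..t-i. \<psi> j (m j)))"
proof -
  define p where "p = (\<lambda>m. \<Prod>j=1..t. \<psi> j (m j))"
  define Q where "Q = (\<lambda>s. {m \<in> {1..t} \<rightarrow>\<^sub>E (UNIV :: nat set). (\<Sum>j=1..t. j * m j) = s})"
  have Q_t: "Q t = partition_mults t" by (simp add: Q_def partition_mults_def)
  \<comment> \<open>Removing one part \<open>i\<close> is a bijection from the partitions of
    \<open>t\<close> containing \<open>i\<close> to all partitions of \<open>t - i\<close>;
    \<open>\<psi>_Suc\<close> trades the factor \<open>m i\<close> for \<open>e i\<close>.\<close>
  have step: "(\<Sum>m\<in>Q t. of_nat (m i) * p m) = e i * (\<Sum>m\<in>Q (t - i). p m)" if i: "i \<in> {1..t}" for i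
  proof -
    have wt: "(\<Sum>j=1..t. j * (m(i := k)) j) = i * k + (\<Sum>j\<in>{1..t}-{i}. j * m j)" for m k
      using i by (subst sum.remove[of _ i]) auto
    have wt0: "(\<Sum>j=1..t. j * m j) = i * m i + (\<Sum>j\<in>{1..t}-{i}. j * m j)" for m
      using i by (subst sum.remove[of _ i]) auto
    have "(\<Sum>m\<in>Q t. of_nat (m i) * p m) = (\<Sum>m | m \<in> Q t \<and> m i > 0. of_nat (m i) * p m)"
      by (rule sum.mono_neutral_right) (auto simp: Q_t finite_partition_mults)
    also have "\<dots> = (\<Sum>m\<in>Q (t - i). e i * p m)"
    proof (rule sum.reindex_bij_witness[where i = "\<lambda>m. m(i := Suc (m i))" and j = "\<lambda>m. m(i := m i - 1)"])
      fix m assume m: "m \<in> {m. m \<in> Q t \<and> m i > 0}"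
      then obtain k where k: "m i = Suc k" by (cases "m i") auto
      show "(m(i := m i - 1))(i := Suc ((m(i := m i - 1)) i)) = m" using k by auto
      show "m(i := m i - 1) \<in> Q (t - i)"
        using m i k wt[of m "m i - 1"] wt0[of m] by (auto simp: Q_def PiE_def extensional_def)
      have "p m = \<psi> i (m i) * (\<Prod>j\<in>{1..t}-{i}. \<psi> j (m j))"
        unfolding p_def using i by (subst prod.remove[of _ i]) auto
      moreover have "p (m(i := m i - 1)) = \<psi> i (m i - 1) * (\<Prod>j\<in>{1..t}-{i}. \<psi> j (m j))"
        unfolding p_def using i by (subst prod.remove[of _ i]) auto
      ultimately show "e i * p (m(i := m i - 1)) = of_nat (m i) * p m"
        using \<psi>_Suc[of k i] unfolding k by (simp only: diff_Suc_1 mult.assoc[symmetric])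
    next
      fix m assume m: "m \<in> Q (t - i)"
      show "(m(i := Suc (m i)))(i := (m(i := Suc (m i))) i - 1) = m" by auto
      show "m(i := Suc (m i)) \<in> {m. m \<in> Q t \<and> m i > 0}"
        using m i wt[of m "Suc (m i)"] wt0[of m] by (auto simp: Q_def PiE_def extensional_def)
    qed
    finally show ?thesis by (simp add: sum_distrib_left)
  qed
  \<comment> \<open>The factor \<open>t\<close> is expanded as the weight
    \<open>\<Sum>i. i * m i\<close> of each partition.\<close>
  have "of_nat t * (\<Sum>m\<in>Q t. p m) = (\<Sum>m\<in>Q t. (\<Sum>i=1..t. of_nat i * (of_nat (m i) * p m)))"
    unfolding sum_distrib_left
  proof (rule sum.cong)
    fix m assume "m \<in> Q t"
    then have "(of_nat t :: 'a) = of_nat (\<Sum>j=1..t. j * m j)" by (simp add: Q_def)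
    then show "of_nat t * p m = (\<Sum>i=1..t. of_nat i * (of_nat (m i) * p m))"
      by (simp add: sum_distrib_right mult.assoc)
  qed simp
  also have "\<dots> = (\<Sum>i=1..t. of_nat i * (\<Sum>m\<in>Q t. of_nat (m i) * p m))"
    by (subst sum.swap) (simp add: sum_distrib_left)
  also have "\<dots> = (\<Sum>i=1..t. of_nat i * e i * (\<Sum>m\<in>Q (t - i). p m))"
    by (rule sum.cong) (simp_all add: step mult.assoc)
  also have "\<dots> = (\<Sum>i=1..t. of_nat i * e i * (\<Sum>m\<in>partition_mults (t - i). \<Prod>j=1..t-i. \<psi> j (m j)))"
    unfolding Q_def p_def by (subst sum_partition_mults_extend[where \<psi> = \<psi>, OF \<psi>0]) auto
  finally show ?thesis by (simp only: Q_t p_def)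
qed

text \<open>\<open>\<Sum>j\<ge>1. E_log j * z^(2j)\<close> is the logarithm of
  \<open>\<Sum>t. E_star t * z^(2t)\<close>.\<close>

definition E_log :: "nat \<Rightarrow> real fps" where
  "E_log j = - (fps_const (bernoulli (2 * j) / (real (2 * j) * fact (2 * j))) * eisenstein j)"

lemma E_star_0: "E_star 0 = 1"
proof -
  have "partition_mults 0 = {\<lambda>_. undefined}"
    by (auto simp: partition_mults_def)
  then show ?thesis by (simp add: E_star_def)
qed

lemma E_star_rec: "of_nat t * E_star t = (\<Sum>i=1..t. of_nat i * E_log i * E_star (t - i))"
proof -
  define \<psi> where "\<psi> = (\<lambda>j n. fps_const (1 / fact n) * E_log j ^ n)"
  have \<psi>_Suc: "of_nat (Suc n) * \<psi> j (Suc n) = E_log j * \<psi> j n" for j n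
  proof -
    have "of_nat (Suc n) * fps_const (1 / fact (Suc n)) = (fps_const (1 / fact n) :: real fps)"
      unfolding fps_of_nat[symmetric] fps_const_mult by (simp del: of_nat_Suc)
    then have "of_nat (Suc n) * \<psi> j (Suc n) = fps_const (1 / fact n) * E_log j ^ Suc n"
      unfolding \<psi>_def by (simp only: mult.assoc[symmetric])
    then show ?thesis by (simp add: \<psi>_def mult_ac)
  qed
  have "E_star s = (\<Sum>m\<in>partition_mults s. \<Prod>j=1..s. \<psi> j (m j))" for s
    by (simp add: E_star_def \<psi>_def E_log_def)
  then show ?thesis
    using sum_partition_mults_rec[of \<psi> E_log t, OF _ \<psi>_Suc] by (simp add: \<psi>_def)
qed

subsection \<open>Truncated generating functions\<close>

definition lambert_factor :: "nat \<Rightarrow> real fps" where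
  "lambert_factor k = fps_X ^ k / (1 - fps_X ^ k)\<^sup>2"

lemma one_minus_fps_X_power_nth_0: "k \<ge> 1 \<Longrightarrow> ((1 - fps_X ^ k)\<^sup>2 :: real fps) $ 0 = 1"
  by (simp add: power2_eq_square fps_X_power_iff)

lemma lambert_factor_mult: "k \<ge> 1 \<Longrightarrow> (1 - fps_X ^ k)\<^sup>2 * lambert_factor k = fps_X ^ k"
  using one_minus_fps_X_power_nth_0[of k] inverse_mult_eq_1'[of "(1 - fps_X ^ k)\<^sup>2 :: real fps"]
  by (simp add: lambert_factor_def fps_divide_unit mult.left_commute)

lemma prod_list_lambert_factor:
  assumes "\<forall>k\<in>set ks. 1 \<le> k"
  shows "fps_X ^ sum_list ks / (\<Prod>k\<leftarrow>ks. (1 - fps_X ^ k)\<^sup>2) = (\<Prod>k\<leftarrow>ks. lambert_factor k)"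
proof -
  have nz: "(\<Prod>k\<leftarrow>ks. (1 - fps_X ^ k)\<^sup>2 :: real fps) $ 0 = 1"
    using assms by (induction ks) (simp_all add: one_minus_fps_X_power_nth_0)
  have "(\<Prod>k\<leftarrow>ks. (1 - fps_X ^ k)\<^sup>2) * (\<Prod>k\<leftarrow>ks. lambert_factor k) = fps_X ^ sum_list ks"
    using assms
  proof (induction ks)
    case (Cons k ks)
    then have "((1 - fps_X ^ k)\<^sup>2 * lambert_factor k) *
        ((\<Prod>k\<leftarrow>ks. (1 - fps_X ^ k)\<^sup>2) * (\<Prod>k\<leftarrow>ks. lambert_factor k)) = fps_X ^ sum_list (k # ks)"
      by (simp add: lambert_factor_mult power_add)
    then show ?case by (simp add: mult_ac)
  qed simp
  moreover have "(\<Prod>k\<leftarrow>ks. (1 - fps_X ^ k)\<^sup>2 :: real fps) \<noteq> 0" using nz by auto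
  ultimately show ?thesis
    by (metis nonzero_mult_div_cancel_left)
qed

text \<open>Each factor is divisible by \<open>q^k\<close>, hence the product by \<open>q\<close> to
  the sum of the list.\<close>

lemma prod_list_lambert_factor_nth:
  assumes "\<forall>k\<in>set ks. 1 \<le> k" "n < sum_list ks"
  shows "(\<Prod>k\<leftarrow>ks. lambert_factor k) $ n = 0"
proof -
  have "fps_X ^ sum_list ks dvd (\<Prod>k\<leftarrow>ks. lambert_factor k)"
    using assms(1)
  proof (induction ks)
    case (Cons k ks)
    have "fps_X ^ k dvd lambert_factor k"
      using Cons.prems by (simp add: lambert_factor_def fps_divide_unit one_minus_fps_X_power_nth_0)
    with Cons show ?case by (simp add: power_add mult_dvd_mono)
  qed simp
  then show ?thesis using assms(2) by (auto simp: dvd_def fps_X_power_mult_nth)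
qed

definition parts_upto :: "nat \<Rightarrow> nat \<Rightarrow> nat list set" where
  "parts_upto N a = {ks. length ks = a \<and> sorted ks \<and> set ks \<subseteq> {1..N}}"

text \<open>This is the complete homogeneous symmetric polynomial of degree \<open>a\<close> in the
  first \<open>N\<close> Lambert factors.\<close>

definition U_trunc :: "nat \<Rightarrow> nat \<Rightarrow> real fps" where
  "U_trunc N a = (\<Sum>ks\<in>parts_upto N a. \<Prod>k\<leftarrow>ks. lambert_factor k)"

lemma finite_parts_upto: "finite (parts_upto N a)"
  by (rule finite_subset[OF _ finite_lists_length_eq[of "{1..N}" a]]) (auto simp: parts_upto_def)

lemma U_trunc_0_left: "U_trunc 0 a = (if a = 0 then 1 else 0)"
proof -
  have "parts_upto 0 a = (if a = 0 then {[]} else {})" by (auto simp: parts_upto_def)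
  then show ?thesis by (simp add: U_trunc_def)
qed

lemma U_trunc_0_right: "U_trunc N 0 = 1"
proof -
  have "parts_upto N 0 = {[]}" by (auto simp: parts_upto_def)
  then show ?thesis by (simp add: U_trunc_def)
qed

text \<open>Lists are split by whether the last, largest entry is \<open>Suc N\<close>. Removing
  that entry keeps the bound \<open>Suc N\<close>, since parts may repeat.\<close>

lemma U_trunc_Suc:
  "U_trunc (Suc N) (Suc a) = U_trunc N (Suc a) + lambert_factor (Suc N) * U_trunc (Suc N) a"
proof -
  let ?f = "\<lambda>ks. ks @ [Suc N]"
  have split: "parts_upto (Suc N) (Suc a) = parts_upto N (Suc a) \<union> ?f ` parts_upto (Suc N) a"
  proof (intro equalityI subsetI)
    fix ks assume ks: "ks \<in> parts_upto (Suc N) (Suc a)"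
    then obtain xs x where xs: "ks = xs @ [x]" by (cases ks rule: rev_cases) (auto simp: parts_upto_def)
    show "ks \<in> parts_upto N (Suc a) \<union> ?f ` parts_upto (Suc N) a"
    proof (cases "x = Suc N")
      case True
      then show ?thesis using ks xs by (auto simp: parts_upto_def sorted_append)
    next
      case False
      then have "x \<le> N" using ks xs by (auto simp: parts_upto_def)
      then have "ks \<in> parts_upto N (Suc a)"
        using ks xs by (force simp: parts_upto_def sorted_append)
      then show ?thesis by blast
    qed
  qed (auto simp: parts_upto_def sorted_append subset_iff)
  have "parts_upto N (Suc a) \<inter> ?f ` parts_upto (Suc N) a = {}"
    by (auto simp: parts_upto_def)
  moreover have "inj_on ?f (parts_upto (Suc N) a)" by (auto intro: inj_onI)
  ultimately show ?thesis
    unfolding U_trunc_def split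
    by (simp add: sum.union_disjoint finite_parts_upto sum.reindex sum_distrib_left mult.commute)
qed

text \<open>Iterated down to \<open>N = 0\<close>, this is the finite product formula for the
  generating function.\<close>

lemma U_trunc_generating:
  "(1 - fps_const (lambert_factor (Suc N)) * fps_X) * Abs_fps (U_trunc (Suc N)) = Abs_fps (U_trunc N)"
proof (rule fps_ext)
  fix a show "((1 - fps_const (lambert_factor (Suc N)) * fps_X) * Abs_fps (U_trunc (Suc N))) $ a
      = Abs_fps (U_trunc N) $ a"
    by (cases a) (simp_all add: left_diff_distrib mult.assoc U_trunc_0_right U_trunc_Suc)
qed

text \<open>A list with an entry above \<open>N\<close> has sum above \<open>n\<close> and does not
  affect the coefficient of \<open>q^n\<close>.\<close>

lemma U_star_nth:
  assumes "n \<le> N"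
  shows "U_star a $ n = U_trunc N a $ n"
proof -
  define A where "A = {ks :: nat list. length ks = a \<and> sorted ks \<and> (\<forall>k\<in>set ks. 1 \<le> k)}"
  define f where "f = (\<lambda>ks. fps_X ^ sum_list ks / (\<Prod>k\<leftarrow>ks. (1 - fps_X ^ k)\<^sup>2) :: real fps)"
  have f: "f ks = (\<Prod>k\<leftarrow>ks. lambert_factor k)" if "ks \<in> A" for ks
    unfolding f_def using that by (intro prod_list_lambert_factor) (auto simp: A_def)
  have "(f has_sum U_star a) A"
    unfolding U_star_def f_def A_def by (rule has_sum_infsum[OF U_star_summable])
  then have "\<forall>\<^sub>F F in finite_subsets_at_top A. (sum f F) $ n = U_star a $ n"
    unfolding has_sum_def tendsto_fps_iff by blast
  then obtain X where X: "finite X" "X \<subseteq> A"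
    "\<forall>Y. finite Y \<and> X \<subseteq> Y \<and> Y \<subseteq> A \<longrightarrow> (sum f Y) $ n = U_star a $ n"
    unfolding eventually_finite_subsets_at_top by (elim exE conjE)
  \<comment> \<open>The coefficient is constant on all finite sets of lists beyond \<open>X\<close>;
    enlarging \<open>X\<close> by the bounded lists stays in that range.\<close>
  define Y where "Y = X \<union> parts_upto N a"
  have sub: "parts_upto N a \<subseteq> A" by (auto simp: parts_upto_def A_def)
  then have Y: "finite Y" "Y \<subseteq> A" using X finite_parts_upto by (auto simp: Y_def)
  have "U_star a $ n = (sum f Y) $ n" using X(3) Y by (simp add: Y_def)
  also have "\<dots> = (\<Sum>ks\<in>Y. f ks $ n)" by (simp add: fps_sum_nth)
  also have "\<dots> = (\<Sum>ks\<in>parts_upto N a. f ks $ n)"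
  proof (rule sum.mono_neutral_right)
    show "\<forall>ks\<in>Y - parts_upto N a. f ks $ n = 0"
    proof
      fix ks assume ks: "ks \<in> Y - parts_upto N a"
      then have ksA: "ks \<in> A" using Y by auto
      then obtain k where k: "k \<in> set ks" "k > N" using ks by (force simp: A_def parts_upto_def)
      then have "n < sum_list ks" using member_le_sum_list[of k ks] assms by simp
      then show "f ks $ n = 0"
        unfolding f[OF ksA] using ksA by (intro prod_list_lambert_factor_nth) (auto simp: A_def)
    qed
  qed (use Y in \<open>auto simp: Y_def\<close>)
  also have "\<dots> = (\<Sum>ks\<in>parts_upto N a. (\<Prod>k\<leftarrow>ks. lambert_factor k) $ n)"
    by (rule sum.cong) (use f sub in auto)
  finally show ?thesis by (simp add: U_trunc_def fps_sum_nth)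
qed

lemma U_star_0: "U_star 0 = 1"
  by (rule fps_ext) (simp add: U_star_nth[OF order_refl] U_trunc_0_right)

subsection \<open>Logarithmic derivatives\<close>

text \<open>Nested series represent series in two variables; this exchanges the outer and the inner
  one.\<close>

definition fps_swap :: "'a::zero fps fps \<Rightarrow> 'a fps fps" where
  "fps_swap F = Abs_fps (\<lambda>i. Abs_fps (\<lambda>n. F $ n $ i))"

lemma fps_swap_nth [simp]: "fps_swap F $ i $ n = F $ n $ i"
  by (simp add: fps_swap_def)

lemma fps_eq_iff2: "F = G \<longleftrightarrow> (\<forall>i n. F $ i $ n = G $ i $ n)"
  by (auto simp: fps_eq_iff)

lemma fps_swap_mult: "fps_swap (F * G) = fps_swap F * fps_swap (G :: 'a::semiring_0 fps fps)"
proof -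
  have "(\<Sum>a=0..n. \<Sum>b=0..i. F $ a $ b * G $ (n - a) $ (i - b)) =
      (\<Sum>b=0..i. \<Sum>a=0..n. F $ a $ b * G $ (n - a) $ (i - b))" for i n
    by (rule sum.swap)
  then show ?thesis unfolding fps_eq_iff2 by (simp add: fps_mult_nth fps_sum_nth)
qed

lemma fps_swap_diff: "fps_swap (F - G) = fps_swap F - fps_swap (G :: 'a::group_add fps fps)"
  by (simp add: fps_eq_iff2)

lemma fps_swap_1: "fps_swap 1 = (1 :: 'a::{zero,one} fps fps)"
  by (simp add: fps_eq_iff2)

text \<open>\<open>fps_const\<close> embeds series in the inner variable, \<open>fps_lift\<close>
  those in the outer variable.\<close>

definition fps_lift :: "'a::zero fps \<Rightarrow> 'a fps fps" where
  "fps_lift f = fps_swap (fps_const f)"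

lemma fps_lift_nth: "fps_lift f $ i = fps_const (f $ i)"
  by (rule fps_ext) (simp add: fps_lift_def)

lemma fps_lift_simps:
  "fps_lift (1 :: 'a::comm_ring_1 fps) = 1"
  "fps_lift (f + g) = fps_lift f + fps_lift (g :: 'a::comm_ring_1 fps)"
  "fps_lift (f - g) = fps_lift f - fps_lift g"
  "fps_lift (f * g) = fps_lift f * fps_lift g"
  "fps_lift (f ^ k) = fps_lift f ^ k"
  "fps_deriv (fps_lift f) = fps_lift (fps_deriv f)"
proof -
  show one: "fps_lift (1 :: 'a fps) = 1" by (simp add: fps_lift_def fps_swap_1)
  show mult: "fps_lift (f * g) = fps_lift f * fps_lift g" for f g :: "'a fps"
    by (simp add: fps_lift_def fps_swap_mult flip: fps_const_mult)
  show "fps_lift (f ^ k) = fps_lift f ^ k" by (induction k) (simp_all add: one mult)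
  show "fps_deriv (fps_lift f) = fps_lift (fps_deriv f)"
    by (rule fps_ext) (simp add: fps_lift_nth flip: fps_of_nat)
qed (rule fps_ext; simp add: fps_lift_nth)+

lemma fps_lift_X [simp]: "fps_lift fps_X = (fps_X :: 'a::comm_ring_1 fps fps)"
  by (rule fps_ext) (simp add: fps_lift_nth fps_X_def)

text \<open>The substituted series is free of the inner variable, so substitution commutes with
  taking an inner coefficient.\<close>

lemma fps_compose_lift_nth:
  "(F oo fps_lift g) $ i $ n = (Abs_fps (\<lambda>k. F $ k $ n) oo g) $ i"
  for F :: "'a::comm_ring_1 fps fps"
  by (simp add: fps_compose_nth fps_sum_nth fps_lift_nth flip: fps_lift_simps)

lemma fps_lift_mult_nth:
  "(fps_lift g * F) $ i $ n = (g * Abs_fps (\<lambda>k. F $ k $ n)) $ i"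
  for F :: "'a::comm_ring_1 fps fps"
  by (simp add: fps_mult_nth[of "fps_lift g"] fps_mult_nth[of g] fps_sum_nth fps_lift_nth)

text \<open>For \<open>k \<ge> 1\<close> this is the expansion of
  \<open>1 / (1 - u X^k)\<close>.\<close>

definition fps_geometric :: "nat \<Rightarrow> 'a::comm_ring_1 \<Rightarrow> 'a fps" where
  "fps_geometric k u = Abs_fps (\<lambda>n. if k dvd n then u ^ (n div k) else 0)"

lemma fps_geometric_mult:
  assumes "k \<ge> 1"
  shows "(1 - fps_const u * fps_X ^ k) * fps_geometric k u = 1"
proof (rule fps_ext)
  fix n
  have eq: "((1 - fps_const u * fps_X ^ k) * fps_geometric k u) $ n =
      fps_geometric k u $ n - (if n < k then 0 else u * fps_geometric k u $ (n - k))"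
    by (simp add: left_diff_distrib mult.assoc fps_X_power_mult_nth)
  show "((1 - fps_const u * fps_X ^ k) * fps_geometric k u) $ n = 1 $ n"
  proof (cases "n < k")
    case True
    then show ?thesis unfolding eq by (auto simp: fps_geometric_def dest: dvd_imp_le)
  next
    case False
    then obtain m where "n = m + k" by (metis add.commute le_Suc_ex not_less)
    then show ?thesis unfolding eq using assms by (simp add: fps_geometric_def)
  qed
qed

text \<open>\<open>log_deriv_term k\<close> is \<open>\<Sum>m\<ge>1. q ^ (k * m) * (exp (m * z) - exp (- m * z))\<close>, with outer
  variable \<open>z\<close> and inner variable \<open>q\<close>. As series in \<open>q\<close> with coefficients in \<open>z\<close> these are
  geometric series, hence the exchange of the two variables.\<close>

definition log_deriv_term :: "nat \<Rightarrow> real fps fps" where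
  "log_deriv_term k = fps_swap (fps_geometric k (fps_exp 1) - fps_geometric k (fps_exp (-1)))"

lemma log_deriv_term_nth:
  "log_deriv_term k $ i $ n = (if k dvd n then (1 - (-1) ^ i) * real (n div k) ^ i / fact i else 0)"
proof -
  have "(- real m) ^ i = (-1) ^ i * real m ^ i" for m
    by (metis mult_minus1 power_mult_distrib)
  then show ?thesis
    by (simp add: log_deriv_term_def fps_geometric_def fps_exp_power_mult diff_divide_distrib left_diff_distrib)
qed

text \<open>With \<open>Q = q^k\<close> the first factor is
  \<open>(1 - e Q) (1 - e' Q) / (1 - Q)^2\<close>, and partial fractions give the two geometric
  series. So \<open>log_deriv_term k\<close> is the logarithmic derivative of the reciprocal of that
  factor.\<close>

lemma log_deriv_term_eq:
  assumes "k \<ge> 1"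
  shows "(1 - fps_const (lambert_factor k) * fps_lift (dsinh_fps\<^sup>2)) * log_deriv_term k =
    fps_const (lambert_factor k) * fps_deriv (fps_lift (dsinh_fps\<^sup>2))"
proof -
  define Q where "Q = (fps_const (fps_X ^ k) :: real fps fps)"
  define l where "l = (fps_const (lambert_factor k) :: real fps fps)"
  define e where "e = (fps_lift (fps_exp 1) :: real fps fps)"
  define e' where "e' = (fps_lift (fps_exp (-1)) :: real fps fps)"
  define G where "G = fps_swap (fps_geometric k (fps_exp 1 :: real fps))"
  define G' where "G' = fps_swap (fps_geometric k (fps_exp (-1) :: real fps))"
  have Q: "Q = fps_swap (fps_X ^ k)"
    by (auto simp: fps_eq_iff2 Q_def fps_X_power_iff)
  have geo: "(1 - fps_lift u * Q) * fps_swap (fps_geometric k u) = 1" for u :: "real fps"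
  proof -
    have "fps_swap ((1 - fps_const u * fps_X ^ k) * fps_geometric k u) = 1"
      by (simp only: fps_geometric_mult[OF assms] fps_swap_1)
    then show ?thesis by (simp only: fps_swap_mult fps_swap_diff fps_swap_1 Q fps_lift_def)
  qed
  have G: "(1 - e * Q) * G = 1" "(1 - e' * Q) * G' = 1"
    unfolding e_def e'_def G_def G'_def by (rule geo)+
  have ee: "e * e' = 1"
    by (simp add: e_def e'_def fps_lift_simps(1) flip: fps_lift_simps(4) fps_exp_add_mult)
  have l: "(1 - Q)\<^sup>2 * l = Q"
    using lambert_factor_mult[OF assms] by (simp add: Q_def l_def power2_eq_square flip: fps_const_1_eq_1)
  have 2: "(2 :: real fps) = 1 + 1" by simp
  have s: "fps_lift (dsinh_fps\<^sup>2) = e + e' - 1 - 1"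
    unfolding dsinh_fps_power2 e_def e'_def 2 fps_lift_simps by simp
  have "fps_deriv (dsinh_fps\<^sup>2) = fps_exp 1 - fps_exp (-1)"
    unfolding dsinh_fps_power2 2 by (simp flip: fps_const_neg)
  then have s': "fps_deriv (fps_lift (dsinh_fps\<^sup>2)) = e - e'"
    by (simp only: fps_lift_simps(3,6) e_def e'_def)
  have M: "log_deriv_term k = G - G'"
    by (simp add: log_deriv_term_def fps_swap_diff G_def G'_def)
  have "(1 - Q)\<^sup>2 * (1 - l * (e + e' - 1 - 1)) = (1 - Q)\<^sup>2 - (1 - Q)\<^sup>2 * l * (e + e' - 1 - 1)"
    by (simp add: algebra_simps)
  also have "\<dots> = 1 - (e + e') * Q + (e * e') * Q\<^sup>2"
    unfolding l ee by (simp add: power2_eq_square algebra_simps)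
  also have "\<dots> = (1 - e * Q) * (1 - e' * Q)" by (simp add: power2_eq_square algebra_simps)
  finally have "(1 - Q)\<^sup>2 * ((1 - l * (e + e' - 1 - 1)) * (G - G')) = (1 - e * Q) * (1 - e' * Q) * (G - G')"
    by (simp only: mult.assoc[symmetric])
  also have "\<dots> = (1 - e' * Q) * ((1 - e * Q) * G) - (1 - e * Q) * ((1 - e' * Q) * G')"
    by (simp add: algebra_simps)
  also have "\<dots> = Q * (e - e')" unfolding G by (simp add: algebra_simps)
  also have "\<dots> = (1 - Q)\<^sup>2 * (l * (e - e'))" unfolding mult.assoc[symmetric] l ..
  finally have "(1 - l * (e + e' - 1 - 1)) * (G - G') = l * (e - e')"
  proof (rule mult_left_cancel[THEN iffD1, rotated])
    have "(1 - Q) $ 0 $ 0 = 1" using assms by (simp add: Q_def fps_X_power_iff)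
    then show "(1 - Q)\<^sup>2 \<noteq> 0" by auto
  qed
  then show ?thesis unfolding s' unfolding M s l_def .
qed

text \<open>Each new factor of the product adds its logarithmic derivative; quotients are avoided by
  multiplying with \<open>1 - l * s\<close>.\<close>

lemma U_trunc_log_deriv:
  "fps_deriv (Abs_fps (U_trunc N) oo fps_lift (dsinh_fps\<^sup>2)) =
    (Abs_fps (U_trunc N) oo fps_lift (dsinh_fps\<^sup>2)) * (\<Sum>k=1..N. log_deriv_term k)"
proof (induction N)
  case 0
  have "Abs_fps (U_trunc 0) = 1" by (rule fps_ext) (simp add: U_trunc_0_left)
  then show ?case by simp
next
  case (Suc N)
  define s where "s = fps_lift (dsinh_fps\<^sup>2)"
  define l where "l = (fps_const (lambert_factor (Suc N)) :: real fps fps)"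
  define P where "P = (\<lambda>N. Abs_fps (U_trunc N) oo s)"
  define L where "L = (\<Sum>k=1..N. log_deriv_term k)"
  have s0: "s $ 0 = 0" by (simp add: s_def fps_lift_nth)
  have "((1 - l * fps_X) * Abs_fps (U_trunc (Suc N))) oo s = P N"
    unfolding P_def l_def by (simp only: U_trunc_generating)
  then have P: "(1 - l * s) * P (Suc N) = P N"
    by (simp add: fps_compose_mult_distrib[OF s0] fps_compose_sub_distrib s0 P_def l_def)
  have "fps_deriv (P N) = P N * L" using Suc by (simp add: P_def L_def s_def)
  moreover have "fps_deriv (P N) = (1 - l * s) * fps_deriv (P (Suc N)) - l * fps_deriv s * P (Suc N)"
    unfolding P[symmetric] by (simp add: l_def)
  moreover have "(1 - l * s) * log_deriv_term (Suc N) = l * fps_deriv s"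
    unfolding l_def s_def by (rule log_deriv_term_eq) simp
  ultimately have "(1 - l * s) * fps_deriv (P (Suc N)) = (1 - l * s) * (P (Suc N) * (L + log_deriv_term (Suc N)))"
    using P by algebra
  moreover have "(1 - l * s) $ 0 = 1" by (simp add: l_def s0)
  then have "1 - l * s \<noteq> 0" by (metis fps_zero_nth zero_neq_one)
  ultimately show ?case by (simp add: P_def L_def s_def)
qed

text \<open>This is the limit of the sums of \<open>log_deriv_term\<close>; the sign factor leaves
  only odd powers of \<open>z\<close>.\<close>

definition sigma_series :: "real fps fps" where
  "sigma_series = Abs_fps (\<lambda>i. Abs_fps (\<lambda>n.
    if n = 0 then 0 else (1 - (-1) ^ i) * real (divisor_sigma i n) / fact i))"

lemma sum_log_deriv_term_nth:
  assumes "n \<le> N"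
  shows "(\<Sum>k=1..N. log_deriv_term k) $ i $ n = sigma_series $ i $ n"
proof (cases "n = 0")
  case True
  \<comment> \<open>Every \<open>k\<close> divides 0, so no term drops out by divisibility;
    \<open>0 ^ i\<close> vanishes for \<open>i > 0\<close> and the sign factor for
    \<open>i = 0\<close>.\<close>
  have "(1 - (-1) ^ i) * (0 :: real) ^ i = 0" by (cases i) auto
  then show ?thesis using True by (simp add: fps_sum_nth log_deriv_term_nth sigma_series_def)
next
  case False
  have "(\<Sum>k=1..N. log_deriv_term k) $ i $ n =
      (\<Sum>k=1..N. if k dvd n then (1 - (-1) ^ i) * real (n div k) ^ i / fact i else 0)"
    by (simp add: fps_sum_nth log_deriv_term_nth)
  also have "\<dots> = (\<Sum>k | k dvd n. (1 - (-1) ^ i) * real (n div k) ^ i / fact i)"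
  proof (rule sum.mono_neutral_cong_right)
    show "{k. k dvd n} \<subseteq> {1..N}"
    proof
      fix k assume "k \<in> {k. k dvd n}"
      then have "k \<le> n" "k \<noteq> 0" using False by (auto dest: dvd_imp_le)
      then show "k \<in> {1..N}" using assms by simp
    qed
  qed auto
  \<comment> \<open>Passage to the complementary divisor \<open>d = n div k\<close>.\<close>
  also have "\<dots> = (\<Sum>d | d dvd n. (1 - (-1) ^ i) * real d ^ i / fact i)"
    by (rule sum.reindex_bij_witness[where i = "\<lambda>d. n div d" and j = "\<lambda>d. n div d"])
      (use False in \<open>auto elim!: dvdE\<close>)
  finally show ?thesis
    using False by (simp add: sigma_series_def divisor_sigma_def sum_distrib_left sum_divide_distrib)
qed

text \<open>The coefficient of \<open>q^n\<close> on either side uses only coefficients up to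
  \<open>n\<close> in \<open>q\<close>, where truncation at \<open>N = n\<close> is exact.\<close>

lemma U_star_log_deriv:
  "fps_deriv (Abs_fps U_star oo fps_lift (dsinh_fps\<^sup>2)) =
    (Abs_fps U_star oo fps_lift (dsinh_fps\<^sup>2)) * sigma_series"
proof -
  define P where "P = (Abs_fps U_star oo fps_lift (dsinh_fps\<^sup>2))"
  define PN where "PN = (\<lambda>N. Abs_fps (U_trunc N) oo fps_lift (dsinh_fps\<^sup>2))"
  have eq: "P $ i $ n = PN N $ i $ n" if "n \<le> N" for i n N
    unfolding P_def PN_def fps_compose_lift_nth by (simp add: U_star_nth[OF that])
  have "fps_deriv P $ i $ n = (P * sigma_series) $ i $ n" for i n
  proof -
    define L where "L = (\<Sum>k=1..n. log_deriv_term k)"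
    have "fps_deriv P $ i $ n = fps_deriv (PN n) $ i $ n"
      by (simp add: eq[OF order_refl] flip: fps_of_nat del: of_nat_Suc)
    also have "\<dots> = (PN n * L) $ i $ n"
      by (simp only: PN_def L_def U_trunc_log_deriv)
    also have "\<dots> = (P * sigma_series) $ i $ n"
      unfolding fps_mult_nth fps_sum_nth
    proof (intro sum.cong refl)
      fix j m assume "m \<in> {0..n}"
      then show "PN n $ j $ m * L $ (i - j) $ (n - m) =
          P $ j $ m * sigma_series $ (i - j) $ (n - m)"
        by (simp add: L_def sum_log_deriv_term_nth eq del: One_nat_def)
    qed
    finally show ?thesis .
  qed
  then show ?thesis unfolding P_def fps_eq_iff2 by blast
qed

section \<open>The logarithmic derivative of the generating function of
  \<open>E_star\<close>\<close>

lemma fps_compose_X_power2_nth: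
  "(F oo fps_X\<^sup>2) $ i = (if even i then F $ (i div 2) else 0)"
  for F :: "'a::comm_ring_1 fps"
proof -
  have "((fps_X\<^sup>2) ^ k :: 'a fps) $ i = (if i = 2 * k then 1 else 0)" for k
    unfolding power_mult[symmetric] by (simp add: fps_X_power_iff)
  then have "(F oo fps_X\<^sup>2) $ i = (\<Sum>k\<in>{0..i}. if i = 2 * k then F $ k else 0)"
    unfolding fps_compose_nth by (intro sum.cong) simp_all
  also have "\<dots> = (\<Sum>k\<in>(if even i then {i div 2} else {}). F $ k)"
    by (rule sum.mono_neutral_cong_right) (auto split: if_splits)
  finally show ?thesis by auto
qed

text \<open>For \<open>n > 0\<close> the Bernoulli number cancels against the denominator in
  \<open>eisenstein\<close>, which is where its nonvanishing enters.\<close>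

lemma E_log_nth:
  assumes "j \<ge> 1"
  shows "(2 * of_nat j * E_log j) $ n =
    (if n = 0 then - bern_fps $ (2 * j) else 2 * real (divisor_sigma (2 * j - 1) n) / fact (2 * j - 1))"
proof -
  have f: "(fact (2 * j) :: real) = 2 * real j * fact (2 * j - 1)"
    using assms by (cases j) (auto simp: algebra_simps)
  have b: "bernoulli (2 * j) \<noteq> 0" by (rule bernoulli_even_nonzero[OF assms])
  have "(2 * of_nat j * E_log j) $ n = 2 * real j * E_log j $ n"
    by (simp add: mult.assoc numeral_fps_const flip: fps_of_nat)
  also have "E_log j $ n = (if n = 0 then - (bernoulli (2 * j) / (2 * real j * fact (2 * j)))
      else 2 * real (divisor_sigma (2 * j - 1) n) / fact (2 * j))"
    using b assms by (simp add: E_log_def eisenstein_def)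
  finally show ?thesis
    using assms f by (simp add: bernoulli_even[OF assms, symmetric])
qed

text \<open>By \<open>E_star_rec\<close> the factor on the right is
  \<open>\<Sum>j. 2 j E_log j z^(2j)\<close>. Constant terms in \<open>q\<close> give
  \<open>1 - bern_fps\<close>, the divisor sums give \<open>z * sigma_series\<close>.\<close>

lemma E_star_deriv:
  defines "EE \<equiv> Abs_fps E_star oo fps_X\<^sup>2"
  shows "fps_X * fps_deriv EE = EE * (1 - fps_lift bern_fps + fps_X * sigma_series)"
proof -
  define F where "F = Abs_fps (\<lambda>j. 2 * of_nat j * E_log j)"
  have s0: "(fps_X\<^sup>2 :: real fps fps) $ 0 = 0" by simp
  \<comment> \<open>For \<open>x = z^2\<close> the operator \<open>z d/dz\<close> is
    \<open>2 x d/dx\<close>, hence the factor 2 here and in \<open>F\<close>.\<close>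
  have "fps_X * fps_deriv (Abs_fps E_star) * 2 = Abs_fps E_star * F"
  proof (rule fps_ext)
    fix t
    have "(fps_X * fps_deriv (Abs_fps E_star) * 2) $ t = 2 * (of_nat t * E_star t)"
      by (cases t) (simp_all add: mult.commute numeral_fps_const)
    also have "\<dots> = (\<Sum>i=1..t. (2 * of_nat i * E_log i) * E_star (t - i))"
      unfolding E_star_rec by (simp add: sum_distrib_left mult.assoc)
    also have "\<dots> = (\<Sum>i=0..t. F $ i * E_star (t - i))"
      by (simp add: F_def sum.atLeast_Suc_atMost[of 0])
    also have "\<dots> = (Abs_fps E_star * F) $ t"
      by (simp add: fps_mult_nth mult.commute[of "Abs_fps E_star"])
    finally show "(fps_X * fps_deriv (Abs_fps E_star) * 2) $ t = (Abs_fps E_star * F) $ t" .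
  qed
  then have "(fps_X * fps_deriv (Abs_fps E_star) * 2) oo fps_X\<^sup>2 = EE * (F oo fps_X\<^sup>2)"
    by (simp only: EE_def fps_compose_mult_distrib[OF s0])
  moreover have "fps_deriv EE = (fps_deriv (Abs_fps E_star) oo fps_X\<^sup>2) * (2 * fps_X)"
    unfolding EE_def fps_compose_deriv[OF s0] by (simp add: fps_deriv_power numeral_fps_const)
  moreover have "(2 :: real fps fps) oo fps_X\<^sup>2 = 2" by (simp add: numeral_fps_const)
  moreover have "(fps_X * fps_deriv (Abs_fps E_star) * 2) oo fps_X\<^sup>2 =
      fps_X\<^sup>2 * (fps_deriv (Abs_fps E_star) oo fps_X\<^sup>2) * (2 :: real fps fps)"
    using \<open>(2 :: real fps fps) oo fps_X\<^sup>2 = 2\<close>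
    by (simp only: fps_compose_mult_distrib[OF s0] fps_X_fps_compose_startby0[OF s0])
  ultimately have "fps_X * fps_deriv EE = EE * (F oo fps_X\<^sup>2)"
    by (simp only: power2_eq_square mult_ac)
  moreover have "F oo fps_X\<^sup>2 = 1 - fps_lift bern_fps + fps_X * sigma_series"
  proof -
    have "(F oo fps_X\<^sup>2) $ i $ n = (1 - fps_lift bern_fps + fps_X * sigma_series) $ i $ n" for i n
    proof (cases "odd i \<or> i = 0")
      case True
      have "(fps_X * sigma_series) $ i $ n = 0"
        using True by (auto simp: fps_X_mult_nth sigma_series_def)
      then show ?thesis using True
        by (auto simp: fps_compose_X_power2_nth F_def fps_lift_nth bern_fps_nth_odd bern_fps_nth_0)
    next
      case False
      then obtain j where j: "i = 2 * j" "j \<ge> 1" by (auto elim!: evenE)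
      then have "odd (2 * j - 1)" by auto
      then show ?thesis using j
        by (simp add: fps_compose_X_power2_nth F_def E_log_nth fps_lift_nth fps_X_mult_nth sigma_series_def)
    qed
    then show ?thesis unfolding fps_eq_iff2 by blast
  qed
  ultimately show ?thesis by simp
qed

section \<open>The identity of generating functions and the comparison of coefficients\<close>

lemma fps_linear_ode_unique:
  fixes P Q L :: "'a::{idom,semiring_char_0} fps"
  assumes "fps_deriv P = P * L" "fps_deriv Q = Q * L" "P $ 0 = Q $ 0"
  shows "P = Q"
proof (rule fps_ext)
  fix n show "P $ n = Q $ n"
  proof (induction n rule: less_induct)
    case (less n)
    show ?case
    proof (cases n)
      case (Suc m)
      \<comment> \<open>The right side involves only coefficients of \<open>P\<close> below
        \<open>n\<close>; characteristic 0 later cancels \<open>n\<close>.\<close>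
      have "of_nat n * P $ n = (P * L) $ m" using Suc assms(1)[symmetric] by simp
      also have "\<dots> = (Q * L) $ m" unfolding fps_mult_nth using Suc by (intro sum.cong) (auto simp: less)
      also have "\<dots> = of_nat n * Q $ n" using Suc assms(2)[symmetric] by simp
      finally show ?thesis using Suc by (simp del: of_nat_Suc)
    qed (use assms in simp)
  qed
qed

text \<open>Both sides solve \<open>P' = P * sigma_series\<close> with constant term 1: the
  contribution \<open>bern_fps - 1\<close> of \<open>dsinhc_fps\<close> cancels
  \<open>1 - bern_fps\<close> from \<open>E_star_deriv\<close>.\<close>

lemma U_star_generating:
  "Abs_fps U_star oo fps_lift (dsinh_fps\<^sup>2) = fps_lift dsinhc_fps * (Abs_fps E_star oo fps_X\<^sup>2)"
proof (rule fps_linear_ode_unique[OF U_star_log_deriv])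
  define c where "c = (fps_lift dsinhc_fps :: real fps fps)"
  define EE where "EE = (Abs_fps E_star oo fps_X\<^sup>2 :: real fps fps)"
  have "fps_X * fps_deriv c = fps_lift (fps_X * fps_deriv dsinhc_fps)"
    by (simp add: c_def fps_lift_simps)
  also have "\<dots> = c * (fps_lift bern_fps - 1)"
    unfolding fps_X_deriv_dsinhc by (simp add: c_def fps_lift_simps)
  finally have c: "fps_X * fps_deriv c = c * (fps_lift bern_fps - 1)" .
  have "fps_X * fps_deriv EE = EE * (1 - fps_lift bern_fps + fps_X * sigma_series)"
    unfolding EE_def by (rule E_star_deriv)
  with c have "fps_X * (fps_deriv c * EE + c * fps_deriv EE) = fps_X * (c * EE * sigma_series)"
    by algebra
  then have "fps_deriv c * EE + c * fps_deriv EE = c * EE * sigma_series"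
    by (rule mult_left_cancel[THEN iffD1, rotated]) simp
  then show "fps_deriv (c * EE) = c * EE * sigma_series" by (simp add: add.commute)
  show "(Abs_fps U_star oo fps_lift (dsinh_fps\<^sup>2)) $ 0 = (c * EE) $ 0"
    by (simp add: c_def EE_def fps_lift_nth dsinhc_fps_nth_0 U_star_0 E_star_0)
qed

text \<open>Since \<open>h ^ t\<close> starts in degree \<open>t\<close> or later, all inner sums
  may run up to the same bound \<open>n\<close> and be exchanged.\<close>

lemma fps_mult_compose_nth:
  fixes V B h :: "'a::idom fps"
  assumes "h $ 0 = 0"
  shows "(V * (B oo h)) $ n = (\<Sum>t=0..n. B $ t * (V * h ^ t) $ n)"
proof -
  have "(B oo h) $ (n - j) = (\<Sum>t=0..n. B $ t * h ^ t $ (n - j))" if "j \<le> n" for j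
    unfolding fps_compose_nth
    using that by (intro sum.mono_neutral_left) (auto simp: startsby_zero_power_prefix[OF assms])
  then have "(V * (B oo h)) $ n = (\<Sum>j=0..n. \<Sum>t=0..n. B $ t * (V $ j * h ^ t $ (n - j)))"
    by (simp add: fps_mult_nth sum_distrib_left mult.left_commute)
  also have "\<dots> = (\<Sum>t=0..n. B $ t * (V * h ^ t) $ n)"
    by (subst sum.swap) (simp add: fps_mult_nth sum_distrib_left)
  finally show ?thesis .
qed

theorem theorem1p4:
  fixes a :: nat
  shows "U_star a = (\<Sum>t=0..a. fps_const (w_star t a) * E_star t)"
proof (rule fps_ext)
  fix n
  \<comment> \<open>Fixing the power \<open>q^n\<close> leaves series in one variable with real
    coefficients.\<close>
  define A where "A = Abs_fps (\<lambda>a. U_star a $ n)"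
  define B where "B = Abs_fps (\<lambda>t. E_star t $ n)"
  define g where "g = darsinh_fps"
  have g0: "g $ 0 = 0" by (simp add: g_def)
  have s0: "(dsinh_fps\<^sup>2) $ 0 = 0" by simp
  have x0: "(fps_X\<^sup>2 :: real fps) $ 0 = 0" by simp
  have "A oo dsinh_fps\<^sup>2 = dsinhc_fps * (B oo fps_X\<^sup>2)"
  proof (rule fps_ext)
    fix i
    have "(A oo dsinh_fps\<^sup>2) $ i = (Abs_fps U_star oo fps_lift (dsinh_fps\<^sup>2)) $ i $ n"
      by (simp add: fps_compose_lift_nth A_def)
    also have "\<dots> = (dsinhc_fps * Abs_fps (\<lambda>k. (Abs_fps E_star oo fps_X\<^sup>2) $ k $ n)) $ i"
      unfolding U_star_generating fps_lift_mult_nth ..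
    also have "Abs_fps (\<lambda>k. (Abs_fps E_star oo fps_X\<^sup>2) $ k $ n) = B oo fps_X\<^sup>2"
      by (rule fps_ext) (simp add: B_def fps_compose_X_power2_nth)
    finally show "(A oo dsinh_fps\<^sup>2) $ i = (dsinhc_fps * (B oo fps_X\<^sup>2)) $ i" .
  qed
  \<comment> \<open>Substituting \<open>z = g(y)\<close> turns \<open>dsinh_fps\<^sup>2\<close> into
    \<open>y^2\<close>, so \<open>A\<close> can be read off at even degrees.\<close>
  then have "A oo dsinh_fps\<^sup>2 oo g = (dsinhc_fps oo g) * (B oo fps_X\<^sup>2 oo g)"
    by (simp add: fps_compose_mult_distrib[OF g0])
  moreover have "A oo dsinh_fps\<^sup>2 oo g = A oo fps_X\<^sup>2"
    using dsinh_darsinh[folded g_def]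
    by (simp add: fps_compose_assoc[OF g0 s0, symmetric] fps_compose_power[OF g0, symmetric])
  moreover have "B oo fps_X\<^sup>2 oo g = B oo g\<^sup>2"
    by (simp add: fps_compose_assoc[OF g0 x0, symmetric] fps_compose_power[OF g0, symmetric] g0)
  ultimately have "(A oo fps_X\<^sup>2) $ (2 * a) = ((dsinhc_fps oo g) * (B oo g\<^sup>2)) $ (2 * a)"
    by simp
  also have "\<dots> = (\<Sum>t=0..2*a. B $ t * ((dsinhc_fps oo g) * g ^ (2 * t)) $ (2 * a))"
    by (subst fps_mult_compose_nth) (simp_all add: g0 power_mult)
  \<comment> \<open>The terms with \<open>a < t \<le> 2 * a\<close> vanish by
    \<open>dsinhc_darsinh_power_nth\<close>.\<close>
  also have "\<dots> = (\<Sum>t=0..a. w_star t a * B $ t)"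
    unfolding g_def dsinhc_darsinh_power_nth by (rule sum.mono_neutral_cong_right) auto
  finally show "U_star a $ n = (\<Sum>t=0..a. fps_const (w_star t a) * E_star t) $ n"
    by (simp add: fps_compose_X_power2_nth A_def B_def fps_sum_nth)
qed

end
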